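(* Let $n,t\ge1$ be integers, $\mathbb R[X]:=\mathbb R[X_1,\ldots,X_n]$ and $\sigma=\sum_{i=1}^nX_i^2$. Let $\mathcal G\subseteq\mathcal S_t(\mathbb R[X])$ be a finite set of homogeneous polynomial matrices of even degrees. Let $\mathbf F\in\mathcal S_t(\mathbb R[X])$ be a homogeneous polynomial matrix of even degree $d>0$. If $\mathbf F(x)\ge0$ (positive semidefinite) for all $x\in K(\mathcal G)$, then there exist a finite set $G$ of homogeneous polynomials in $\mathbb R[X]$ of even degrees and a real number $\lambda>0$ such that for every real $\epsilon>0$ there exists an integer $N>0$ with $N\ge d/2$ satisfying $$\sigma^{N-d/2}\Big(\mathbf F+\frac{\epsilon}{\lambda^d}\sigma^{d/2}\mathbf I\Big)\in M(G)^t\subseteq\mathcal M(\mathcal G).$$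
   Context: $\mathcal M_t(\mathbb R[X])$ is the algebra of $t\times t$ matrices over $\mathbb R[X]$ ("polynomial matrices"), $\mathbf I$ is the identity matrix, and $\mathcal S_t(\mathbb R[X])$ is the subset of symmetric matrices. The degree of a polynomial matrix is the maximum of the degrees of its entries; it is homogeneous of degree $d$ if it has the form $\sum_{|\alpha|=d}\mathbf A_\alpha X^\alpha$ with $\mathbf A_\alpha\in\mathcal M_t(\mathbb R)$. For $\mathcal G\subseteq\mathcal S_t(\mathbb R[X])$, $K(\mathcal G)=\{x\in\mathbb R^n:\mathbf G(x)\text{ is positive semidefinite for all }\mathbf G\in\mathcal G\}$, and $\mathcal M(\mathcal G)$ is the quadratic module generated by $\mathcal G$: the set of all finite sums of matrices $\mathbf A^T\mathbf G\mathbf A$ with $\mathbf G\in\mathcal G\cup\{\mathbf I\}$ and $\mathbf A\in\mathcal M_t(\mathbb R[X])$. For $G\subseteq\mathbb R[X]$, $M(G)$ is the set of all $\sigma_0+\sum_{i=1}^m\sigma_ig_i$ with $m\in\mathbb N$, $g_i\in G$ and $\sigma_i$ finite sums of squares of polynomials in $\mathbb R[X]$. For a quadratic module $M\subseteq\mathbb R[X]$, $M^t$ is the set of all finite sums $\sum_i m_i\mathbf A_i^T\mathbf A_i$ with $m_i\in M$ and $\mathbf A_i\in\mathcal M_t(\mathbb R[X])$. *)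

theory Defs
  imports "HOL-Analysis.Analysis" "HOL-Library.Poly_Mapping"
begin

text \<open>
  The finite type \<open>'n\<close> indexes the variables, so \<open>'n rpoly\<close> is
  \<open>\<real>[X\<^sub>1, \<dots>, X\<^sub>n]\<close> with \<open>n = CARD('n)\<close>. A polynomial is its finitely supported
  coefficient function on exponent vectors, with the convolution product.
  Likewise \<open>t = CARD('t)\<close> for \<open>t \<times> t\<close> matrices.
\<close>

type_synonym 'n expo = "'n \<Rightarrow>\<^sub>0 nat"
type_synonym 'n rpoly = "'n expo \<Rightarrow>\<^sub>0 real"
type_synonym ('n, 't) pmat = "'n rpoly ^ 't ^ 't"

definition PConst :: "real \<Rightarrow> 'n::finite rpoly" where
  "PConst c = Poly_Mapping.single 0 c"

definition PVar :: "'n \<Rightarrow> 'n::finite rpoly" where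
  "PVar i = Poly_Mapping.single (Poly_Mapping.single i 1) 1"

definition sigma :: "'n::finite rpoly" where
  "sigma = (\<Sum>i\<in>UNIV. PVar i ^ 2)"

definition total_deg :: "'n::finite expo \<Rightarrow> nat" where
  "total_deg \<alpha> = (\<Sum>i\<in>UNIV. Poly_Mapping.lookup \<alpha> i)"

definition eval_poly :: "real ^ 'n \<Rightarrow> 'n::finite rpoly \<Rightarrow> real" where
  "eval_poly x p =
     (\<Sum>\<alpha>\<in>Poly_Mapping.keys p. Poly_Mapping.lookup p \<alpha> * (\<Prod>i\<in>UNIV. (x $ i) ^ Poly_Mapping.lookup \<alpha> i))"

definition eval_pmat :: "real ^ 'n \<Rightarrow> ('n::finite, 't::finite) pmat \<Rightarrow> real ^ 't ^ 't" where
  "eval_pmat x F = map_matrix (eval_poly x) F"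

definition pscale :: "'n::finite rpoly \<Rightarrow> ('n, 't::finite) pmat \<Rightarrow> ('n, 't) pmat" where
  "pscale p A = map_matrix (\<lambda>q. p * q) A"

text \<open>The index sets of the two sums below are finite, so these are genuine sums.\<close>

lemma finite_total_deg: "finite {\<alpha> :: 'n::finite expo. total_deg \<alpha> = d}"
proof -
  let ?S = "{\<alpha> :: 'n expo. total_deg \<alpha> = d}"
  have le: "Poly_Mapping.lookup \<alpha> i \<le> d" if "total_deg \<alpha> = d" for \<alpha> :: "'n expo" and i
    using member_le_sum[of i UNIV "Poly_Mapping.lookup \<alpha>"] that
    by (simp add: total_deg_def)
  have "Poly_Mapping.lookup ` ?S \<subseteq> PiE UNIV (\<lambda>_. {..d})"
    using le by auto
  moreover have "finite (PiE (UNIV :: 'n set) (\<lambda>_. {..d}))"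
    by (rule finite_PiE) auto
  ultimately have "finite (Poly_Mapping.lookup ` ?S)"
    by (rule finite_subset)
  then show ?thesis
    by (rule finite_imageD) (auto simp: inj_on_def intro: poly_mapping_eqI)
qed

text \<open>The zero polynomial (matrix) is homogeneous of every degree.\<close>

definition homogeneous_poly :: "nat \<Rightarrow> 'n::finite rpoly \<Rightarrow> bool" where
  "homogeneous_poly d p \<longleftrightarrow>
     (\<exists>c :: 'n expo \<Rightarrow> real. p = (\<Sum>\<alpha> | total_deg \<alpha> = d. Poly_Mapping.single \<alpha> (c \<alpha>)))"

definition homogeneous_pmat :: "nat \<Rightarrow> ('n::finite, 't::finite) pmat \<Rightarrow> bool" where
  "homogeneous_pmat d F \<longleftrightarrow>
     (\<exists>A :: 'n expo \<Rightarrow> real ^ 't ^ 't.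
        F = (\<Sum>\<alpha> | total_deg \<alpha> = d. map_matrix (Poly_Mapping.single \<alpha>) (A \<alpha>)))"

definition symmetric_mat :: "'a ^ 't ^ 't \<Rightarrow> bool" where
  "symmetric_mat A \<longleftrightarrow> transpose A = A"

definition psd :: "real ^ 't ^ 't::finite \<Rightarrow> bool" where
  "psd A \<longleftrightarrow> symmetric_mat A \<and> (\<forall>v. v \<bullet> (A *v v) \<ge> 0)"

definition K_set :: "('n::finite, 't::finite) pmat set \<Rightarrow> (real ^ 'n) set" where
  "K_set \<G> = {x. \<forall>G\<in>\<G>. psd (eval_pmat x G)}"

definition finite_sums :: "'a::comm_monoid_add set \<Rightarrow> 'a set" where
  "finite_sums S = sum_list ` lists S"

definition matrix_qm :: "('n::finite, 't::finite) pmat set \<Rightarrow> ('n, 't) pmat set" where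
  "matrix_qm \<G> = finite_sums {transpose A ** G ** A | (A :: ('n, 't) pmat) G. G \<in> \<G> \<union> {mat 1}}"

definition sos :: "'n::finite rpoly set" where
  "sos = finite_sums {p ^ 2 | p. True}"

definition scalar_qm :: "'n::finite rpoly set \<Rightarrow> 'n rpoly set" where
  "scalar_qm G = {s 0 + (\<Sum>i=1..m. s i * g i) | (m::nat) s g.
     (\<forall>i\<in>{0..m}. s i \<in> sos) \<and> (\<forall>i\<in>{1..m}. g i \<in> G)}"

text \<open>The set \<open>M\<^sup>t\<close>; the size \<open>t\<close> is determined by the result type.\<close>

definition qm_lift :: "'n::finite rpoly set \<Rightarrow> ('n, 't::finite) pmat set" where
  "qm_lift M = finite_sums {pscale m (transpose A ** A) | m (A :: ('n, 't) pmat). m \<in> M}"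

end

theory Submission
  imports Defs
begin

text \<open>
  For a vector \<open>v\<close> of polynomials, \<open>(v\<^sup>T G v) I\<close> lies in the quadratic module of \<open>G\<close>. Division-free Schur
  complements produce finitely many such \<open>v\<close> for which nonnegativity of all \<open>v\<^sup>T G v\<close> at a point forces \<open>G\<close>
  to be positive semidefinite there; these are the scalar constraints \<open>g\<close>, and one may take \<open>\<lambda> = 1\<close>.

  Let \<open>H = F + \<epsilon> \<sigma>\<^bsup>d/2\<^esup> I\<close>, which is positive definite on the part of the unit sphere where all \<open>g \<ge> 0\<close>. After
  scaling to \<open>g \<le> 1\<close> on the sphere, subtracting the homogenised elements \<open>g (1 - g)\<^bsup>2k\<^esup>\<close> of the quadratic
  module, for \<open>k\<close> large, makes it positive definite on the whole sphere: this term is at most \<open>1/(2k)\<close>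
  where \<open>g \<ge> 0\<close>, and at most \<open>-2k g\<^sup>2\<close> where \<open>g < 0\<close>.

  A form that is positive definite on the sphere is rewritten in the squares
  \<open>(X\<^sub>i \<plusminus> X\<^sub>j)\<^sup>2 / 4n\<close>, which sum to \<open>\<sigma>\<close>. A penalty vanishing on the image of the sphere makes it positive
  definite on the whole simplex, so that after multiplication by a power of \<open>\<sigma>\<close> all its coefficients become
  positive semidefinite (Polya). Here the coefficient of a word \<open>w\<close> of length \<open>M\<close> is the average of the original
  coefficients over the injective ways to read a word of length \<open>D\<close> off \<open>w\<close>; for large \<open>M\<close> almost all maps are
  injective, and the average over all maps is the value of the form at the letter frequencies of \<open>w\<close>.
\<close>

section \<open>Evaluation and homogeneity\<close>

lemma eval_poly_superset:
  assumes "finite S" "Poly_Mapping.keys p \<subseteq> S"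
  shows "eval_poly x p =
    (\<Sum>\<alpha>\<in>S. Poly_Mapping.lookup p \<alpha> * (\<Prod>i\<in>UNIV. (x $ i) ^ Poly_Mapping.lookup \<alpha> i))"
  unfolding eval_poly_def using assms
  by (intro sum.mono_neutral_left) (auto simp: in_keys_iff)

lemma eval_poly_add: "eval_poly x (p + q) = eval_poly x p + eval_poly x q"
proof -
  let ?S = "Poly_Mapping.keys p \<union> Poly_Mapping.keys q"
  have "Poly_Mapping.keys (p + q) \<subseteq> ?S" by (rule Poly_Mapping.keys_add)
  then show ?thesis
    by (simp add: eval_poly_superset[of ?S] lookup_add distrib_right sum.distrib)
qed

lemma eval_poly_single:
  "eval_poly x (Poly_Mapping.single \<alpha> c) = c * (\<Prod>i\<in>UNIV. (x $ i) ^ Poly_Mapping.lookup \<alpha> i)"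
  using eval_poly_superset[of "{\<alpha>}" "Poly_Mapping.single \<alpha> c" x] by simp

lemma eval_poly_0 [simp]: "eval_poly x 0 = 0"
  by (simp add: eval_poly_def)

lemma eval_poly_1 [simp]: "eval_poly x 1 = 1"
  using eval_poly_single[of x 0 1] by simp

lemma eval_poly_sum: "eval_poly x (\<Sum>i\<in>I. f i) = (\<Sum>i\<in>I. eval_poly x (f i))"
  by (induction I rule: infinite_finite_induct) (auto simp: eval_poly_add)

lemma poly_mapping_sum_single:
  "p = (\<Sum>\<alpha>\<in>Poly_Mapping.keys p. Poly_Mapping.single \<alpha> (Poly_Mapping.lookup p \<alpha>))"
  by (rule poly_mapping_eqI)
    (auto simp: lookup_sum lookup_single when_def in_keys_iff)

lemma eval_poly_mult: "eval_poly x (p * q) = eval_poly x p * eval_poly x q"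
proof -
  have single: "eval_poly x (Poly_Mapping.single \<alpha> a * Poly_Mapping.single \<beta> b) =
      eval_poly x (Poly_Mapping.single \<alpha> a) * eval_poly x (Poly_Mapping.single \<beta> b)"
    for \<alpha> \<beta> :: "'a expo" and a b
    by (simp add: mult_single eval_poly_single lookup_add power_add prod.distrib)
  \<comment> \<open>Fresh names stand for the two expanded factors: the monomial expansion of
    \<open>p\<close> mentions \<open>p\<close> again, so rewriting with it in place would never
    end.\<close>
  have "eval_poly x (p' * q') = eval_poly x p' * eval_poly x q'"
    if "p' = (\<Sum>\<alpha>\<in>Poly_Mapping.keys p. Poly_Mapping.single \<alpha> (Poly_Mapping.lookup p \<alpha>))"
      and "q' = (\<Sum>\<alpha>\<in>Poly_Mapping.keys q. Poly_Mapping.single \<alpha> (Poly_Mapping.lookup q \<alpha>))" for p' q'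
    unfolding that sum_product eval_poly_sum single by simp
  then show ?thesis using poly_mapping_sum_single by blast
qed

lemma eval_poly_uminus: "eval_poly x (- p) = - eval_poly x p"
  using eval_poly_add[of x p "- p"] by simp

lemma eval_poly_diff: "eval_poly x (p - q) = eval_poly x p - eval_poly x q"
  using eval_poly_add[of x p "- q"] by (simp add: eval_poly_uminus)

lemma eval_poly_power: "eval_poly x (p ^ k) = eval_poly x p ^ k"
  by (induction k) (auto simp: eval_poly_mult)

lemma eval_poly_PConst [simp]: "eval_poly x (PConst c) = c"
  by (simp add: PConst_def eval_poly_single)

lemma eval_poly_PVar [simp]: "eval_poly x (PVar i) = x $ i"
proof -
  have "(\<Prod>j\<in>UNIV. (x $ j) ^ (1 when i = j)) = (\<Prod>j\<in>UNIV. if i = j then x $ j else 1)"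
    by (rule prod.cong) (auto simp: when_def)
  then show ?thesis
    by (simp add: PVar_def eval_poly_single lookup_single)
qed

lemmas eval_poly_simps = eval_poly_add eval_poly_mult eval_poly_uminus eval_poly_diff
  eval_poly_power eval_poly_sum

lemma eval_poly_sigma: "eval_poly x sigma = (norm x)\<^sup>2"
  by (simp add: sigma_def eval_poly_simps norm_vec_def L2_set_def sum_nonneg)

lemma continuous_on_eval_poly: "continuous_on S (\<lambda>x. eval_poly x p)"
  unfolding eval_poly_def by (intro continuous_intros)

lemma PConst_0 [simp]: "PConst 0 = 0" and PConst_1 [simp]: "PConst 1 = 1"
  by (auto simp: PConst_def)

lemma PConst_add: "PConst (a + b) = PConst a + PConst b"
  and PConst_uminus: "PConst (- a) = - PConst a"
  and PConst_mult: "PConst (a * b) = PConst a * PConst b"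
  by (auto simp: PConst_def single_add single_uminus mult_single)

lemma PConst_sum: "PConst (\<Sum>i\<in>I. f i) = (\<Sum>i\<in>I. PConst (f i))"
  by (induction I rule: infinite_finite_induct) (auto simp: PConst_add)

lemma PConst_power: "PConst (a ^ k) = PConst a ^ k"
  by (induction k) (auto simp: PConst_mult)

lemma PConst_prod: "PConst (\<Prod>i\<in>I. f i) = (\<Prod>i\<in>I. PConst (f i))"
  by (induction I rule: infinite_finite_induct) (auto simp: PConst_mult)

section \<open>Homogeneity read off the support\<close>

lemma sum_single_total_deg:
  assumes "\<forall>\<alpha>\<in>Poly_Mapping.keys p. total_deg \<alpha> = d"
  shows "p = (\<Sum>\<alpha> | total_deg \<alpha> = d. Poly_Mapping.single \<alpha> (Poly_Mapping.lookup p \<alpha>))"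
proof -
  have "p = (\<Sum>\<alpha>\<in>Poly_Mapping.keys p. Poly_Mapping.single \<alpha> (Poly_Mapping.lookup p \<alpha>))"
    by (rule poly_mapping_sum_single)
  also have "\<dots> = (\<Sum>\<alpha> | total_deg \<alpha> = d. Poly_Mapping.single \<alpha> (Poly_Mapping.lookup p \<alpha>))"
    using assms by (intro sum.mono_neutral_left finite_total_deg) (auto simp: in_keys_iff)
  finally show ?thesis .
qed

text \<open>In terms of supports, closure under sums, products and negation follows from the
  corresponding facts about \<open>keys\<close>.\<close>

lemma homogeneous_poly_iff_keys:
  "homogeneous_poly d p \<longleftrightarrow> (\<forall>\<alpha>\<in>Poly_Mapping.keys p. total_deg \<alpha> = d)"
proof
  assume "homogeneous_poly d p"
  then obtain c :: "'a expo \<Rightarrow> real"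
    where p: "p = (\<Sum>\<alpha> | total_deg \<alpha> = d. Poly_Mapping.single \<alpha> (c \<alpha>))"
    by (auto simp: homogeneous_poly_def)
  show "\<forall>\<alpha>\<in>Poly_Mapping.keys p. total_deg \<alpha> = d"
  proof
    fix \<beta> assume "\<beta> \<in> Poly_Mapping.keys p"
    then have "(\<Sum>\<alpha> | total_deg \<alpha> = d. (c \<alpha> when \<alpha> = \<beta>)) \<noteq> 0"
      by (simp add: in_keys_iff p lookup_sum lookup_single)
    then obtain \<alpha> where "total_deg \<alpha> = d" "(c \<alpha> when \<alpha> = \<beta>) \<noteq> 0"
      using sum.not_neutral_contains_not_neutral by (metis (mono_tags, lifting) mem_Collect_eq)
    then show "total_deg \<beta> = d" by (auto simp: when_def split: if_splits)
  qed
next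
  assume "\<forall>\<alpha>\<in>Poly_Mapping.keys p. total_deg \<alpha> = d"
  then show "homogeneous_poly d p"
    unfolding homogeneous_poly_def using sum_single_total_deg by blast
qed

lemma homogeneous_pmat_iff:
  "homogeneous_pmat d F \<longleftrightarrow> (\<forall>i j. homogeneous_poly d (F $ i $ j))"
proof
  assume "homogeneous_pmat d F"
  then obtain A :: "'a expo \<Rightarrow> real ^ 'b ^ 'b"
    where F: "F = (\<Sum>\<alpha> | total_deg \<alpha> = d. map_matrix (Poly_Mapping.single \<alpha>) (A \<alpha>))"
    by (auto simp: homogeneous_pmat_def)
  have "F $ i $ j = (\<Sum>\<alpha> | total_deg \<alpha> = d. Poly_Mapping.single \<alpha> (A \<alpha> $ i $ j))" for i j
    by (simp add: F)
  then show "\<forall>i j. homogeneous_poly d (F $ i $ j)"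
    unfolding homogeneous_poly_def by (intro allI exI)
next
  assume "\<forall>i j. homogeneous_poly d (F $ i $ j)"
  then have "F $ i $ j = (\<Sum>\<alpha> | total_deg \<alpha> = d.
      Poly_Mapping.single \<alpha> (Poly_Mapping.lookup (F $ i $ j) \<alpha>))" for i j
    by (intro sum_single_total_deg) (simp add: homogeneous_poly_iff_keys)
  then have "F = (\<Sum>\<alpha> | total_deg \<alpha> = d. map_matrix (Poly_Mapping.single \<alpha>)
      (\<chi> i j. Poly_Mapping.lookup (F $ i $ j) \<alpha>))"
    by (simp add: vec_eq_iff)
  then show "homogeneous_pmat d F"
    unfolding homogeneous_pmat_def
    by (intro exI[where x = "\<lambda>\<alpha>. \<chi> i j. Poly_Mapping.lookup (F $ i $ j) \<alpha>"])
qed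

lemma homogeneous_poly_0 [simp]: "homogeneous_poly d 0"
  by (simp add: homogeneous_poly_iff_keys)

lemma homogeneous_poly_add:
  "homogeneous_poly d p \<Longrightarrow> homogeneous_poly d q \<Longrightarrow> homogeneous_poly d (p + q)"
  using Poly_Mapping.keys_add[of p q] by (auto simp: homogeneous_poly_iff_keys)

lemma homogeneous_poly_sum:
  "(\<And>i. i \<in> I \<Longrightarrow> homogeneous_poly d (f i)) \<Longrightarrow> homogeneous_poly d (\<Sum>i\<in>I. f i)"
  by (induction I rule: infinite_finite_induct) (auto intro: homogeneous_poly_add)

lemma total_deg_add: "total_deg (\<alpha> + \<beta>) = total_deg \<alpha> + total_deg \<beta>"
  by (simp add: total_deg_def lookup_add sum.distrib)

lemma homogeneous_poly_mult:
  "homogeneous_poly d p \<Longrightarrow> homogeneous_poly e q \<Longrightarrow> homogeneous_poly (d + e) (p * q)"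
  using keys_mult[of p q] by (fastforce simp: homogeneous_poly_iff_keys total_deg_add)

lemma homogeneous_poly_PConst: "homogeneous_poly 0 (PConst c)"
  by (simp add: homogeneous_poly_iff_keys PConst_def total_deg_def)

lemma homogeneous_poly_uminus: "homogeneous_poly d p \<Longrightarrow> homogeneous_poly d (- p)"
  by (simp add: homogeneous_poly_iff_keys in_keys_iff)

lemma homogeneous_poly_diff:
  "homogeneous_poly d p \<Longrightarrow> homogeneous_poly d q \<Longrightarrow> homogeneous_poly d (p - q)"
  using homogeneous_poly_add[of d p "- q"] by (simp add: homogeneous_poly_uminus)

lemma homogeneous_poly_power: "homogeneous_poly d p \<Longrightarrow> homogeneous_poly (k * d) (p ^ k)"
  using homogeneous_poly_PConst[of 1]
  by (induction k) (auto intro: homogeneous_poly_mult)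

lemma homogeneous_poly_PVar: "homogeneous_poly 1 (PVar i)"
  by (simp add: homogeneous_poly_iff_keys PVar_def total_deg_def lookup_single when_def)

lemma homogeneous_poly_sigma: "homogeneous_poly 2 sigma"
  unfolding sigma_def
  using homogeneous_poly_power[OF homogeneous_poly_PVar, where k = 2]
  by (intro homogeneous_poly_sum) simp

lemma homogeneous_poly_sigma_power: "homogeneous_poly (2 * k) (sigma ^ k)"
  using homogeneous_poly_power[OF homogeneous_poly_sigma, of k] by (simp add: mult.commute)

section \<open>Polynomial matrices at a point\<close>

lemma nth_eval_pmat [simp]: "eval_pmat x F $ i $ j = eval_poly x (F $ i $ j)"
  by (simp add: eval_pmat_def)

lemma nth_pscale [simp]: "pscale p F $ i $ j = p * F $ i $ j"
  by (simp add: pscale_def)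

lemma eval_pmat_mult: "eval_pmat x (A ** B) = eval_pmat x A ** eval_pmat x B"
  by (simp add: vec_eq_iff matrix_matrix_mult_def eval_poly_simps)

lemma eval_pmat_transpose: "eval_pmat x (transpose A) = transpose (eval_pmat x A)"
  by (simp add: vec_eq_iff transpose_def)

lemma symmetric_mat_iff: "symmetric_mat A \<longleftrightarrow> (\<forall>i j. A $ i $ j = A $ j $ i)"
  by (auto simp: symmetric_mat_def vec_eq_iff transpose_def)

lemma symmetric_mat_eval_pmat: "symmetric_mat F \<Longrightarrow> symmetric_mat (eval_pmat x F)"
  by (simp add: symmetric_mat_iff)

section \<open>Reduction to scalar constraints\<close>

lemma finite_sums_0 [simp]: "0 \<in> finite_sums S"
  unfolding finite_sums_def by (rule image_eqI[of _ _ "[]"]) auto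

lemma finite_sums_add: "a \<in> finite_sums S \<Longrightarrow> b \<in> finite_sums S \<Longrightarrow> a + b \<in> finite_sums S"
proof -
  assume "a \<in> finite_sums S" "b \<in> finite_sums S"
  then obtain xs ys where "a = sum_list xs" "b = sum_list ys" "xs \<in> lists S" "ys \<in> lists S"
    unfolding finite_sums_def by blast
  then show ?thesis
    unfolding finite_sums_def by (intro image_eqI[of _ _ "xs @ ys"]) auto
qed

lemma finite_sums_base: "a \<in> S \<Longrightarrow> a \<in> finite_sums S"
  unfolding finite_sums_def by (rule image_eqI[of _ _ "[a]"]) auto

lemma finite_sums_sum: "(\<And>i. i \<in> I \<Longrightarrow> f i \<in> finite_sums S) \<Longrightarrow> (\<Sum>i\<in>I. f i) \<in> finite_sums S"
  by (induction I rule: infinite_finite_induct) (auto intro: finite_sums_add)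

text \<open>The induction principle for finite sums: an additive map need only be checked on
  generators. With the identity as \<open>f\<close> it yields inclusions between sets of finite
  sums.\<close>

lemma finite_sums_map:
  assumes "a \<in> finite_sums S" "f 0 = 0" "\<And>x y. f (x + y) = f x + f y"
    and "\<And>x. x \<in> S \<Longrightarrow> f x \<in> finite_sums T"
  shows "f a \<in> finite_sums T"
proof -
  obtain xs where a: "a = sum_list xs" "xs \<in> lists S"
    using assms(1) unfolding finite_sums_def by blast
  have "f (sum_list xs) \<in> finite_sums T"
    using a(2) by (induction xs) (auto simp: assms intro: finite_sums_add)
  then show ?thesis by (simp add: a)
qed

lemma matrix_qm_add: "A \<in> matrix_qm \<G> \<Longrightarrow> B \<in> matrix_qm \<G> \<Longrightarrow> A + B \<in> matrix_qm \<G>"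
  unfolding matrix_qm_def by (rule finite_sums_add)

lemma matrix_qm_sum: "(\<And>i. i \<in> I \<Longrightarrow> f i \<in> matrix_qm \<G>) \<Longrightarrow> (\<Sum>i\<in>I. f i) \<in> matrix_qm \<G>"
  unfolding matrix_qm_def by (rule finite_sums_sum)

lemma matrix_qm_base:
  "G \<in> \<G> \<union> {mat 1} \<Longrightarrow> transpose A ** G ** A \<in> matrix_qm \<G>"
  unfolding matrix_qm_def by (rule finite_sums_base) blast

lemma matrix_add_distrib_right: "((A + B) :: 'a::semiring_1 ^ 'n ^ 'm) ** C = A ** C + B ** C"
  by (simp add: vec_eq_iff matrix_matrix_mult_def sum.distrib distrib_right)

lemma matrix_qm_congruence:
  fixes X :: "('n::finite, 't::finite) pmat"
  assumes "X \<in> matrix_qm \<G>"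
  shows "transpose B ** X ** B \<in> matrix_qm \<G>"
  unfolding matrix_qm_def
proof (rule finite_sums_map[OF assms[unfolded matrix_qm_def], of "\<lambda>X. transpose B ** X ** B"])
  fix X :: "('n, 't) pmat" assume "X \<in> {transpose A ** G ** A |A G. G \<in> \<G> \<union> {mat 1}}"
  then obtain A G where X: "X = transpose A ** G ** A" "G \<in> \<G> \<union> {mat 1}" by blast
  have "transpose B ** X ** B = transpose (A ** B) ** G ** (A ** B)"
    by (simp add: X matrix_transpose_mul matrix_mul_assoc)
  then show "transpose B ** X ** B \<in> finite_sums {transpose A ** G ** A |A G. G \<in> \<G> \<union> {mat 1}}"
    using matrix_qm_base[OF X(2), of "A ** B"] by (simp add: matrix_qm_def)
qed (simp_all add: matrix_add_ldistrib matrix_add_distrib_right)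

lemma matrix_qm_trans:
  fixes X :: "('n::finite, 't::finite) pmat"
  assumes "X \<in> matrix_qm \<G>" "\<G> \<subseteq> matrix_qm \<H>"
  shows "X \<in> matrix_qm \<H>"
  unfolding matrix_qm_def
proof (rule finite_sums_map[OF assms(1)[unfolded matrix_qm_def], of "\<lambda>X. X"])
  fix X :: "('n, 't) pmat" assume "X \<in> {transpose A ** G ** A |A G. G \<in> \<G> \<union> {mat 1}}"
  then obtain A G where X: "X = transpose A ** G ** A" "G \<in> \<G> \<or> G = mat 1" by blast
  have "X \<in> matrix_qm \<H>"
    using X(2) assms(2) matrix_qm_congruence[of G \<H> A] matrix_qm_base[of G \<H> A]
    by (auto simp: X(1))
  then show "X \<in> finite_sums {transpose A ** G ** A |A G. G \<in> \<H> \<union> {mat 1}}"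
    by (simp add: matrix_qm_def)
qed auto

section \<open>Symmetric real matrices, their kernels and Schur complements\<close>

lemma inner_symmetric_mat:
  assumes "symmetric_mat (A :: real ^ 't ^ 't)"
  shows "v \<bullet> (A *v w) = w \<bullet> (A *v v)"
  using assms dot_lmul_matrix[of v A w] transpose_matrix_vector[of A v]
  by (simp add: symmetric_mat_def inner_commute)

text \<open>The case \<open>i = j\<close> gives the diagonal, and then the mixed entries follow by
  symmetry. That finitely many test vectors detect a nonzero form is what keeps the set of scalar
  constraints finite.\<close>

lemma symmetric_mat_polarization:
  fixes A :: "real ^ 't ^ 't"
  assumes "symmetric_mat A"
    and "\<And>i j. (axis i 1 + axis j 1) \<bullet> (A *v (axis i 1 + axis j 1)) = 0"
  shows "A = 0"
proof -
  have ax: "axis i 1 \<bullet> (A *v axis j 1) = A $ i $ j" for i j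
    by (simp add: inner_axis' matrix_vector_mult_basis column_def)
  have expand: "A $ i $ i + A $ i $ j + (A $ j $ i + A $ j $ j) = 0" for i j
    using assms(2)[of i j] by (simp add: matrix_vector_right_distrib inner_add_left inner_add_right ax)
  have "A $ i $ j = 0" for i j
    using expand[of i i] expand[of j j] expand[of i j] assms(1)[unfolded symmetric_mat_iff]
    by (metis add_cancel_right_right add_cancel_right_left double_zero)
  then show ?thesis by (simp add: vec_eq_iff)
qed

text \<open>The measure behind both inductions on matrices: each elimination step makes it grow
  strictly, and only the zero matrix reaches \<open>CARD('t)\<close>.\<close>

definition kernel_dim :: "real ^ 't ^ 't::finite \<Rightarrow> nat" where
  "kernel_dim A = dim {v. A *v v = 0}"

lemma subspace_kernel: "subspace {v. (A :: real ^ 't ^ 't) *v v = 0}"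
  by (auto simp: subspace_def matrix_vector_right_distrib matrix_vector_mult_scaleR)

lemma kernel_dim_less:
  assumes "\<And>v. A *v v = 0 \<Longrightarrow> B *v v = 0" "B *v u = 0" "A *v u \<noteq> 0"
  shows "kernel_dim A < kernel_dim B"
  unfolding kernel_dim_def
proof (rule dim_psubset)
  show "span {v. A *v v = 0} \<subset> span {v. B *v v = 0}"
    using assms by (auto simp: span_eq_iff[THEN iffD2, OF subspace_kernel])
qed

lemma kernel_dim_full:
  assumes "CARD('t) \<le> kernel_dim (A :: real ^ 't ^ 't)"
  shows "A = 0"
proof -
  have "dim {v. A *v v = 0} = DIM(real ^ 't)"
    using assms dim_subset_UNIV[of "{v. A *v v = 0}"] by (simp add: kernel_dim_def)
  then have "span {v. A *v v = 0} = UNIV" by (metis dim_eq_full)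
  then have "{v. A *v v = 0} = UNIV" by (simp add: span_eq_iff[THEN iffD2, OF subspace_kernel])
  then have "A *v v = 0 *v v" for v by (auto simp: set_eq_iff)
  then show ?thesis by (simp add: matrix_eq)
qed

text \<open>For \<open>a = u\<^sup>T A u\<close> the congruence by \<open>a I - u (A u)\<^sup>T\<close> is a division-free Schur complement: it maps
  \<open>A\<close> to \<open>a (a A - (A u) (A u)\<^sup>T)\<close>, whose kernel contains \<open>u\<close> in addition to that of \<open>A\<close>.\<close>

definition schur :: "real ^ 't ^ 't \<Rightarrow> real ^ 't \<Rightarrow> real ^ 't ^ 't::finite" where
  "schur A u = (\<chi> i j. (if i = j then u \<bullet> (A *v u) else 0) - u $ i * (A *v u) $ j)"

lemma schur_mult_vec:
  "schur A u *v w = (u \<bullet> (A *v u)) *\<^sub>R w - ((A *v u) \<bullet> w) *\<^sub>R u"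
proof -
  have "(schur A u *v w) $ i = ((u \<bullet> (A *v u)) *\<^sub>R w - ((A *v u) \<bullet> w) *\<^sub>R u) $ i" for i
  proof -
    have "(schur A u *v w) $ i = (\<Sum>j\<in>UNIV. (if i = j then (u \<bullet> (A *v u)) * w $ j else 0)
        - u $ i * ((A *v u) $ j * w $ j))"
      unfolding matrix_vector_mult_def[of "schur A u"]
      by (auto simp: schur_def algebra_simps intro!: sum.cong)
    also have "\<dots> = (u \<bullet> (A *v u)) * w $ i - u $ i * ((A *v u) \<bullet> w)"
      by (simp add: sum_subtractf sum_distrib_left inner_vec_def[of "A *v u" w])
    finally show ?thesis by simp
  qed
  then show ?thesis by (simp add: vec_eq_iff)
qed

text \<open>For symmetric \<open>A\<close>, the last factor on the right is the Cauchy-Schwarz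
  defect of the form at \<open>u\<close> and \<open>w\<close>.\<close>

lemma inner_schur:
  assumes "symmetric_mat A"
  shows "(schur A u *v w) \<bullet> (A *v (schur A u *v w)) =
    (u \<bullet> (A *v u)) * ((u \<bullet> (A *v u)) * (w \<bullet> (A *v w)) - ((A *v u) \<bullet> w)\<^sup>2)"
  using inner_symmetric_mat[OF assms, of u w]
  by (simp add: schur_mult_vec matrix_vector_mult_diff_distrib matrix_vector_mult_scaleR
      inner_diff_left inner_diff_right inner_commute[of w] power2_eq_square algebra_simps)

lemma inner_congruence:
  "w \<bullet> ((transpose P ** A ** P) *v w) = (P *v w) \<bullet> (A *v (P *v w))" for A P :: "real ^ 't ^ 't"
proof -
  have "w \<bullet> ((transpose P ** A ** P) *v w) = w \<bullet> (transpose P *v (A *v (P *v w)))"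
    by (simp add: matrix_vector_mul_assoc matrix_mul_assoc)
  also have "\<dots> = (P *v w) \<bullet> (A *v (P *v w))"
    by (metis dot_lmul_matrix transpose_matrix_vector transpose_transpose)
  finally show ?thesis .
qed

text \<open>Since \<open>schur A u\<close> annihilates \<open>u\<close>, it is not invertible, and
  the congruence cannot simply be undone. Instead, cancelling the positive factor leaves
  \<open>a * (w \<bullet> (A *v w))\<close> above a square, where \<open>a\<close> is the value of
  the form at \<open>u\<close>.\<close>

lemma psd_schur_imp_psd:
  assumes "symmetric_mat A" "u \<bullet> (A *v u) > 0" "psd (transpose (schur A u) ** A ** schur A u)"
  shows "psd A"
  unfolding psd_def
proof (intro conjI allI assms(1))
  fix w
  let ?a = "u \<bullet> (A *v u)"
  have "0 \<le> ?a * (?a * (w \<bullet> (A *v w)) - ((A *v u) \<bullet> w)\<^sup>2)"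
    using assms(3) by (simp add: psd_def inner_congruence inner_schur[OF assms(1)])
  then have "0 \<le> ?a * (w \<bullet> (A *v w)) - ((A *v u) \<bullet> w)\<^sup>2"
    using assms(2) by (simp add: zero_le_mult_iff)
  then have "0 \<le> ?a * (w \<bullet> (A *v w))" by (smt (verit) zero_le_power2)
  then show "0 \<le> w \<bullet> (A *v w)"
    using assms(2) by (simp add: zero_le_mult_iff)
qed

lemma kernel_dim_schur:
  assumes "symmetric_mat A" "u \<bullet> (A *v u) \<noteq> 0"
  shows "kernel_dim A < kernel_dim (transpose (schur A u) ** A ** schur A u)"
proof (rule kernel_dim_less)
  fix v assume v: "A *v v = 0"
  have "(A *v u) \<bullet> v = 0"
    using inner_symmetric_mat[OF assms(1), of v u] v by (simp add: inner_commute)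
  then have "A *v (schur A u *v v) = 0"
    by (simp add: schur_mult_vec matrix_vector_mult_scaleR v)
  then show "(transpose (schur A u) ** A ** schur A u) *v v = 0"
    by (simp add: matrix_vector_mul_assoc[symmetric])
next
  have "schur A u *v u = 0" by (simp add: schur_mult_vec inner_commute)
  then show "(transpose (schur A u) ** A ** schur A u) *v u = 0"
    by (simp add: matrix_vector_mul_assoc[symmetric])
qed (use assms in auto)

text \<open>Completing the square: for \<open>a = u \<bullet> (A *v u) > 0\<close>, subtracting the
  rank-one matrix of \<open>A *v u\<close> divided by \<open>a\<close> leaves a positive
  semidefinite matrix whose kernel has gained \<open>u\<close>.\<close>

lemma psd_sum_rank_one:
  fixes A :: "real ^ 't::finite ^ 't"
  assumes "psd A"
  shows "\<exists>vs :: (real ^ 't) list. A = (\<Sum>v\<leftarrow>vs. \<chi> i j. v $ i * v $ j)"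
proof -
  \<comment> \<open>The number \<open>k\<close> bounds the rank of \<open>A\<close>, so at most
    \<open>k\<close> eliminations remain.\<close>
  have "\<exists>vs :: (real ^ 't) list. A = (\<Sum>v\<leftarrow>vs. \<chi> i j. v $ i * v $ j)"
    if "psd A" "CARD('t) \<le> kernel_dim A + k" for k and A :: "real ^ 't ^ 't"
    using that
  proof (induction k arbitrary: A)
    case 0
    then have "A = 0" by (simp add: kernel_dim_full)
    then show ?case by (intro exI[of _ "[]"]) simp
  next
    case (Suc k)
    have sym: "symmetric_mat A" using Suc.prems by (simp add: psd_def)
    show ?case
    proof (cases "A = 0")
      case True
      then show ?thesis by (intro exI[of _ "[]"]) simp
    next
      case False
      then obtain u where "u \<bullet> (A *v u) \<noteq> 0"
        using symmetric_mat_polarization[OF sym] by blast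
      then have a: "u \<bullet> (A *v u) > 0"
        using Suc.prems(1) by (auto simp: psd_def less_le)
      define a where "a = u \<bullet> (A *v u)"
      define v where "v = (1 / sqrt a) *\<^sub>R (A *v u)"
      define B where "B = A - (\<chi> i j. v $ i * v $ j)"
      have vv: "v $ i * v $ j = (A *v u) $ i * (A *v u) $ j / a" for i j
        using a by (simp add: v_def a_def)
      have B_mult: "B *v w = A *v w - (((A *v u) \<bullet> w) / a) *\<^sub>R (A *v u)" for w
      proof -
        have "(B *v w) $ i = (A *v w - (((A *v u) \<bullet> w) / a) *\<^sub>R (A *v u)) $ i" for i
        proof -
          have "(B *v w) $ i =
              (\<Sum>j\<in>UNIV. A $ i $ j * w $ j - (A *v u) $ i / a * ((A *v u) $ j * w $ j))"
            unfolding matrix_vector_mult_def[of B]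
            by (auto simp: B_def vv algebra_simps intro!: sum.cong)
          also have "\<dots> = (A *v w) $ i - (A *v u) $ i / a * ((A *v u) \<bullet> w)"
            by (simp add: sum_subtractf sum_distrib_left inner_vec_def[of "A *v u" w]
                matrix_vector_mult_def[of A w])
          finally show ?thesis by simp
        qed
        then show ?thesis by (simp add: vec_eq_iff)
      qed
      have "psd B"
        unfolding psd_def
      proof (intro conjI allI)
        show "symmetric_mat B"
          using sym by (simp add: B_def symmetric_mat_iff mult.commute)
        fix w
        \<comment> \<open>By \<open>inner_schur\<close> this value is \<open>a\<^sup>2\<close> times
          the value of the form of \<open>B\<close> at \<open>w\<close>.\<close>
        have "0 \<le> (schur A u *v w) \<bullet> (A *v (schur A u *v w))"
          using Suc.prems(1) by (simp add: psd_def)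
        then have "0 \<le> a * (w \<bullet> (A *v w)) - ((A *v u) \<bullet> w)\<^sup>2"
          unfolding inner_schur[OF sym] using a by (simp add: zero_le_mult_iff a_def)
        then show "0 \<le> w \<bullet> (B *v w)"
          using a unfolding a_def[symmetric]
          by (simp add: B_mult inner_diff_right inner_commute[of w "A *v u"] field_simps power2_eq_square)
      qed
      moreover have "kernel_dim A < kernel_dim B"
      proof (rule kernel_dim_less)
        fix w assume w: "A *v w = 0"
        have "(A *v u) \<bullet> w = 0"
          using inner_symmetric_mat[OF sym, of w u] w by (simp add: inner_commute)
        then show "B *v w = 0" by (simp add: B_mult w)
      next
        show "B *v u = 0" using a by (simp add: B_mult a_def inner_commute)
      qed (use a in auto)
      ultimately obtain vs where "B = (\<Sum>v\<leftarrow>vs. \<chi> i j. v $ i * v $ j)"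
        using Suc.IH[of B] Suc.prems(2) by auto
      then show ?thesis
        by (intro exI[of _ "v # vs"]) (simp add: B_def algebra_simps)
    qed
  qed
  from this[OF assms, of "CARD('t)"] show ?thesis by simp
qed

section \<open>Scalar constraints that force a polynomial matrix to be positive semidefinite\<close>

definition poly_quad :: "('n, 't) pmat \<Rightarrow> real ^ 't \<Rightarrow> 'n::finite rpoly" where
  "poly_quad H u = (\<Sum>i\<in>UNIV. \<Sum>j\<in>UNIV. PConst (u $ i) * (H $ i $ j * PConst (u $ j)))"

text \<open>The vector \<open>u\<close> is constant, so the entries keep the degree of
  \<open>H\<close>. The congruence of \<open>H\<close> by this matrix then has three times that
  degree, which is again even.\<close>

definition poly_schur :: "('n, 't) pmat \<Rightarrow> real ^ 't \<Rightarrow> ('n::finite, 't::finite) pmat" where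
  "poly_schur H u = (\<chi> i j. (if i = j then poly_quad H u else 0) -
     PConst (u $ i) * (\<Sum>k\<in>UNIV. H $ j $ k * PConst (u $ k)))"

lemma eval_poly_quad: "eval_poly x (poly_quad H u) = u \<bullet> (eval_pmat x H *v u)"
  by (simp add: poly_quad_def eval_poly_simps inner_vec_def matrix_vector_mult_def sum_distrib_left)

lemma eval_poly_schur: "eval_pmat x (poly_schur H u) = schur (eval_pmat x H) u"
  by (simp add: vec_eq_iff poly_schur_def schur_def eval_poly_simps eval_poly_quad
      matrix_vector_mult_def)

lemma homogeneous_poly_quad:
  assumes "homogeneous_pmat e H"
  shows "homogeneous_poly e (poly_quad H u)"
proof -
  have "homogeneous_poly (0 + (e + 0)) (PConst (u $ i) * (H $ i $ j * PConst (u $ j)))" for i j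
    using assms by (intro homogeneous_poly_mult homogeneous_poly_PConst) (simp add: homogeneous_pmat_iff)
  then show ?thesis unfolding poly_quad_def by (intro homogeneous_poly_sum) simp
qed

lemma homogeneous_pmat_poly_schur:
  assumes "homogeneous_pmat e H"
  shows "homogeneous_pmat e (poly_schur H u)"
proof -
  have *: "homogeneous_poly (e + 0) (H $ j $ k * PConst (u $ k))" for j k
    using assms by (intro homogeneous_poly_mult homogeneous_poly_PConst) (simp add: homogeneous_pmat_iff)
  have "homogeneous_poly (0 + e) (PConst (u $ i) * (\<Sum>k\<in>UNIV. H $ j $ k * PConst (u $ k)))" for i j
    using * by (intro homogeneous_poly_mult homogeneous_poly_PConst homogeneous_poly_sum) simp
  then show ?thesis
    unfolding homogeneous_pmat_iff poly_schur_def
    using homogeneous_poly_quad[OF assms] by (auto intro!: homogeneous_poly_diff homogeneous_poly_uminus)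
qed

lemma homogeneous_pmat_mult:
  "homogeneous_pmat d A \<Longrightarrow> homogeneous_pmat e B \<Longrightarrow> homogeneous_pmat (d + e) (A ** B)"
  by (auto simp: homogeneous_pmat_iff matrix_matrix_mult_def
      intro!: homogeneous_poly_sum homogeneous_poly_mult)

text \<open>Let \<open>A k\<close> have \<open>u\<close> as its column \<open>k\<close> and zeros
  elsewhere. Then the congruence of \<open>H\<close> by \<open>A k\<close> has
  \<open>poly_quad H u\<close> at position \<open>(k, k)\<close> as its only entry that can be
  nonzero, and summing over \<open>k\<close> gives a multiple of the identity.\<close>

lemma poly_quad_in_matrix_qm:
  fixes H :: "('n::finite, 't::finite) pmat"
  shows "pscale (poly_quad H u) (mat 1) \<in> matrix_qm {H}"
proof -
  define A :: "'t \<Rightarrow> ('n, 't) pmat" where "A k = (\<chi> i j. if j = k then PConst (u $ i) else 0)" for k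
  have entry: "(transpose (A k) ** H ** A k) $ i $ j =
      (if i = k \<and> j = k then poly_quad H u else 0)" for i j k
  proof -
    have "(transpose (A k) ** H ** A k) $ i $ j =
        (\<Sum>b\<in>UNIV. \<Sum>a\<in>UNIV. A k $ a $ i * (H $ a $ b * A k $ b $ j))"
      by (simp add: matrix_matrix_mult_def transpose_def sum_distrib_right mult.assoc)
    also have "\<dots> = (\<Sum>a\<in>UNIV. \<Sum>b\<in>UNIV. A k $ a $ i * (H $ a $ b * A k $ b $ j))"
      by (rule sum.swap)
    finally show ?thesis by (auto simp: A_def poly_quad_def)
  qed
  have "pscale (poly_quad H u) (mat 1) = (\<Sum>k\<in>UNIV. transpose (A k) ** H ** A k)"
  proof -
    have "(\<Sum>k\<in>UNIV. if i = k \<and> j = k then poly_quad H u else 0) =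
        poly_quad H u * (if i = j then 1 else 0)" for i j :: 't
      by (cases "i = j") (auto intro!: sum.neutral)
    then show ?thesis by (simp add: vec_eq_iff entry mat_def)
  qed
  also have "\<dots> \<in> matrix_qm {H}" by (intro matrix_qm_sum matrix_qm_base) simp
  finally show ?thesis .
qed

text \<open>Recursion over Schur complements. At a point where \<open>H\<close> does not vanish,
  some test vector \<open>u\<close> has nonzero value; its constraint makes that value positive. The
  Schur congruence at \<open>u\<close> has a larger kernel, is positive semidefinite by recursion,
  and passes this back to \<open>H\<close>.\<close>

lemma scalarization:
  fixes H :: "('n::finite, 't::finite) pmat"
  assumes "symmetric_mat H" "homogeneous_pmat e H" "even e"
  shows "\<exists>W. finite W \<and> (\<forall>w\<in>W. (\<exists>e. even e \<and> homogeneous_poly e w) \<and>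
      pscale w (mat 1) \<in> matrix_qm {H}) \<and>
    (\<forall>x. (\<forall>w\<in>W. 0 \<le> eval_poly x w) \<longrightarrow> psd (eval_pmat x H))"
proof -
  \<comment> \<open>The kernel of \<open>eval_pmat x H\<close> varies with \<open>x\<close> while
    \<open>W\<close> must not, so the bound on its dimension is a condition on the points and not on
    \<open>H\<close>. For \<open>k = CARD('t)\<close> every point satisfies it.\<close>
  have "\<exists>W. finite W \<and> (\<forall>w\<in>W. (\<exists>e. even e \<and> homogeneous_poly e w) \<and>
        pscale w (mat 1) \<in> matrix_qm {H}) \<and>
      (\<forall>x. (\<forall>w\<in>W. 0 \<le> eval_poly x w) \<longrightarrow> CARD('t) \<le> kernel_dim (eval_pmat x H) + k \<longrightarrow>
        psd (eval_pmat x H))"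
    if "symmetric_mat H" "homogeneous_pmat e H" "even e" for k e and H :: "('n, 't) pmat"
    using that
  proof (induction k arbitrary: H e)
    case 0
    have "psd (0 :: real ^ 't ^ 't)" by (simp add: psd_def symmetric_mat_iff)
    then have "psd (eval_pmat x H)" if "CARD('t) \<le> kernel_dim (eval_pmat x H)" for x
      using kernel_dim_full[OF that] by simp
    then show ?case by (intro exI[of _ "{}"]) simp
  next
    case (Suc k)
    define S where "S u = transpose (poly_schur H u) ** H ** poly_schur H u" for u
    have sym: "symmetric_mat (S u)" for u
      using Suc.prems(1) by (simp add: S_def symmetric_mat_def matrix_transpose_mul matrix_mul_assoc)
    have hom: "homogeneous_pmat (e + e + e) (S u)" for u
      unfolding S_def
      using Suc.prems(2) homogeneous_pmat_poly_schur[OF Suc.prems(2), of u]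
      by (intro homogeneous_pmat_mult) (auto simp: homogeneous_pmat_iff transpose_def)
    have "\<forall>u. \<exists>W. finite W \<and> (\<forall>w\<in>W. (\<exists>e. even e \<and> homogeneous_poly e w) \<and>
        pscale w (mat 1) \<in> matrix_qm {S u}) \<and>
      (\<forall>x. (\<forall>w\<in>W. 0 \<le> eval_poly x w) \<longrightarrow> CARD('t) \<le> kernel_dim (eval_pmat x (S u)) + k \<longrightarrow>
        psd (eval_pmat x (S u)))"
      using Suc.IH[OF sym hom] Suc.prems(3) by simp
    from choice[OF this] obtain W where fin: "\<And>u. finite (W u)"
      and even: "\<And>u w. w \<in> W u \<Longrightarrow> \<exists>e. even e \<and> homogeneous_poly e w"
      and qm: "\<And>u w. w \<in> W u \<Longrightarrow> pscale w (mat 1) \<in> matrix_qm {S u}"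
      and psd: "\<And>u x. (\<And>w. w \<in> W u \<Longrightarrow> 0 \<le> eval_poly x w) \<Longrightarrow>
        CARD('t) \<le> kernel_dim (eval_pmat x (S u)) + k \<Longrightarrow> psd (eval_pmat x (S u))"
      by metis
    \<comment> \<open>Which test vector succeeds depends on the point, so the constraints of all of
      them are collected.\<close>
    define U where "U = range (\<lambda>(i, j). axis i 1 + axis j 1 :: real ^ 't)"
    define V where "V = (\<Union>u\<in>U. insert (poly_quad H u) (W u))"
    have "finite V" by (auto simp: V_def U_def fin)
    moreover have "(\<exists>e. even e \<and> homogeneous_poly e w) \<and> pscale w (mat 1) \<in> matrix_qm {H}"
      if wV: "w \<in> V" for w
    proof -
      obtain u where "w = poly_quad H u \<or> w \<in> W u" using wV unfolding V_def by blast
      then show ?thesis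
      proof
        assume "w = poly_quad H u"
        then show ?thesis
          using homogeneous_poly_quad[OF Suc.prems(2), of u] Suc.prems(3) poly_quad_in_matrix_qm
          by blast
      next
        assume w: "w \<in> W u"
        have "{S u} \<subseteq> matrix_qm {H}"
          unfolding S_def by (simp add: matrix_qm_base)
        then show ?thesis using even[OF w] matrix_qm_trans[OF qm[OF w]] by blast
      qed
    qed
    moreover have "psd (eval_pmat x H)"
      if nonneg: "\<forall>w\<in>V. 0 \<le> eval_poly x w" and dim: "CARD('t) \<le> kernel_dim (eval_pmat x H) + Suc k"
      for x
    proof (cases "eval_pmat x H = 0")
      case True
      then show ?thesis by (simp add: psd_def symmetric_mat_iff)
    next
      case False
      let ?A = "eval_pmat x H"
      have symA: "symmetric_mat ?A" by (rule symmetric_mat_eval_pmat[OF Suc.prems(1)])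
      obtain i j where ij: "(axis i 1 + axis j 1) \<bullet> (?A *v (axis i 1 + axis j 1)) \<noteq> 0"
        using symmetric_mat_polarization[OF symA] False by blast
      define u where "u = (axis i 1 + axis j 1 :: real ^ 't)"
      have u: "u \<in> U" by (auto simp: U_def u_def)
      then have "0 \<le> u \<bullet> (?A *v u)"
        using nonneg eval_poly_quad[of x H u] by (fastforce simp: V_def)
      then have pos: "0 < u \<bullet> (?A *v u)" using ij by (simp add: u_def)
      have S: "eval_pmat x (S u) = transpose (schur ?A u) ** ?A ** schur ?A u"
        by (simp add: S_def eval_pmat_mult eval_pmat_transpose eval_poly_schur)
      have "psd (eval_pmat x (S u))"
        using nonneg u dim kernel_dim_schur[OF symA, of u] pos
        by (intro psd) (auto simp: V_def S)
      then show ?thesis using psd_schur_imp_psd[OF symA pos] by (simp add: S)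
    qed
    ultimately show ?case by (intro exI[of _ V]) blast
  qed
  from this[OF assms, of "CARD('t)"] show ?thesis by simp
qed

section \<open>Words and injections\<close>

lemma qm_lift_0 [simp]: "0 \<in> qm_lift M"
  by (simp add: qm_lift_def)

lemma qm_lift_add: "A \<in> qm_lift M \<Longrightarrow> B \<in> qm_lift M \<Longrightarrow> A + B \<in> qm_lift M"
  unfolding qm_lift_def by (rule finite_sums_add)

lemma qm_lift_sum: "(\<And>i. i \<in> I \<Longrightarrow> f i \<in> qm_lift M) \<Longrightarrow> (\<Sum>i\<in>I. f i) \<in> qm_lift M"
  unfolding qm_lift_def by (rule finite_sums_sum)

lemma qm_lift_base:
  fixes A :: "('n::finite, 't::finite) pmat"
  shows "m \<in> M \<Longrightarrow> pscale m (transpose A ** A) \<in> qm_lift M"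
  unfolding qm_lift_def by (rule finite_sums_base) blast

text \<open>A positive semidefinite constant matrix is a sum of matrices of rank one, and each of
  these has the form \<open>transpose B ** B\<close>.\<close>

lemma qm_lift_psd:
  fixes A :: "real ^ 't::finite ^ 't"
  assumes "m \<in> M" "psd A"
  shows "pscale m (map_matrix PConst A) \<in> qm_lift M"
proof -
  obtain vs :: "(real ^ 't) list" where A: "A = (\<Sum>v\<leftarrow>vs. \<chi> i j. v $ i * v $ j)"
    using psd_sum_rank_one[OF assms(2)] by blast
  have "pscale m (map_matrix PConst (\<Sum>v\<leftarrow>vs. \<chi> i j. v $ i * v $ j)) \<in> qm_lift M"
  proof (induction vs)
    case Nil
    have "pscale m (map_matrix PConst 0) = (0 :: ('a, 't) pmat)" by (simp add: vec_eq_iff)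
    then show ?case by simp
  next
    case (Cons v vs)
    define r :: 't where "r = undefined"
    define B :: "('a, 't) pmat" where "B = (\<chi> i j. if i = r then PConst (v $ j) else 0)"
    have "pscale m (map_matrix PConst (\<Sum>v\<leftarrow>v # vs. \<chi> i j. v $ i * v $ j)) =
        pscale m (transpose B ** B) + pscale m (map_matrix PConst (\<Sum>v\<leftarrow>vs. \<chi> i j. v $ i * v $ j))"
    proof -
      have "(transpose B ** B) $ i $ j = PConst (v $ i * v $ j)" for i j
      proof -
        have "(transpose B ** B) $ i $ j = (\<Sum>k\<in>UNIV. B $ k $ i * B $ k $ j)"
          by (simp add: matrix_matrix_mult_def transpose_def)
        also have "\<dots> = (\<Sum>k\<in>UNIV. if k = r then PConst (v $ i) * PConst (v $ j) else 0)"
          by (rule sum.cong) (simp_all add: B_def)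
        finally have "(transpose B ** B) $ i $ j =
            (\<Sum>k\<in>UNIV. if k = r then PConst (v $ i) * PConst (v $ j) else 0)" .
        then show ?thesis by (simp add: PConst_mult)
      qed
      then show ?thesis by (simp add: vec_eq_iff PConst_add distrib_left)
    qed
    then show ?case using Cons.IH qm_lift_base[OF assms(1), of B] by (simp add: qm_lift_add)
  qed
  then show ?thesis by (simp add: A)
qed

text \<open>\<open>tform y D f p\<close>: the same form of degree \<open>D\<close> in variables indexed by \<open>'j\<close> gives the real function \<open>f\<close>
  and, after substituting the polynomials \<open>y\<close> for the variables, the polynomial \<open>p\<close>.\<close>

inductive tform ::
    "('j::finite \<Rightarrow> 'n::finite rpoly) \<Rightarrow> nat \<Rightarrow> (real ^ 'j \<Rightarrow> real) \<Rightarrow> 'n rpoly \<Rightarrow> bool"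
  for y D where
  monomial: "tform y D (\<lambda>q. c * (\<Prod>k<D. q $ v k)) (PConst c * (\<Prod>k<D. y (v k)))"
| add: "tform y D f p \<Longrightarrow> tform y D g r \<Longrightarrow> tform y D (\<lambda>q. f q + g q) (p + r)"

lemma tform_const: "tform y 0 (\<lambda>q. c) (PConst c)"
  using tform.monomial[of y 0 c] by simp

lemma tform_var: "tform y 1 (\<lambda>q. q $ j) (y j)"
  using tform.monomial[of y 1 1 "\<lambda>_. j"] by simp

lemma tform_0: "tform y D (\<lambda>q. 0) 0"
  using tform.monomial[of y D 0] by simp

lemma tform_sum:
  "(\<And>i. i \<in> I \<Longrightarrow> tform y D (f i) (p i)) \<Longrightarrow> tform y D (\<lambda>q. \<Sum>i\<in>I. f i q) (\<Sum>i\<in>I. p i)"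
  by (induction I rule: infinite_finite_induct) (auto intro: tform_0 tform.add)

lemma prod_concat:
  "(\<Prod>k<D + E. h (if k < D then v k else v' (k - D))) =
    (\<Prod>k<D. h (v k)) * (\<Prod>k<E. h (v' k) :: 'a::comm_monoid_mult)" for D E :: nat
  by (induction E) (auto simp: mult.assoc)

text \<open>Words rather than exponent vectors index the monomials, so the product of two monomials
  is given by the concatenated word \<open>u\<close>. Distributivity in each factor does the
  rest.\<close>

lemma tform_mult:
  assumes "tform y D f p" "tform y E g r"
  shows "tform y (D + E) (\<lambda>q. f q * g q) (p * r)"
  using assms(1)
proof induction
  case (monomial c v)
  from assms(2) show ?case
  proof induction
    case (monomial c' v')
    define u where "u k = (if k < D then v k else v' (k - D))" for k
    show ?case
      using tform.monomial[of y "D + E" "c * c'" u] by (simp add: u_def prod_concat ac_simps PConst_mult)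
  next
    case (add g r g' r')
    then show ?case using tform.add[OF add.IH] by (simp add: distrib_left)
  qed
next
  case (add f p f' p')
  then show ?case using tform.add[OF add.IH] by (simp add: distrib_right)
qed

lemma tform_cmult: "tform y D f p \<Longrightarrow> tform y D (\<lambda>q. c * f q) (PConst c * p)"
  using tform_mult[OF tform_const[of y c]] by simp

lemma tform_diff:
  assumes "tform y D f p" "tform y D g r"
  shows "tform y D (\<lambda>q. f q - g q) (p - r)"
  using tform.add[OF assms(1) tform_cmult[OF assms(2), of "-1"]] by (simp add: PConst_uminus)

lemma tform_power: "tform y D f p \<Longrightarrow> tform y (k * D) (\<lambda>q. f q ^ k) (p ^ k)"
  using tform_const[of y 1] by (induction k) (auto intro: tform_mult)

lemma continuous_on_tform: "tform y D f p \<Longrightarrow> continuous_on S f"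
  by (induction rule: tform.induct) (auto intro!: continuous_intros)

section \<open>Counting injections and letter frequencies\<close>

definition injections :: "nat \<Rightarrow> nat \<Rightarrow> (nat \<Rightarrow> nat) set" where
  "injections D M = {\<iota> \<in> PiE {..<D} (\<lambda>_. {..<M}). inj_on \<iota> {..<D}}"

lemma finite_injections [simp]: "finite (injections D M)"
  unfolding injections_def by (simp add: finite_PiE)

lemma card_injections_pos: "D \<le> M \<Longrightarrow> card (injections D M) > 0"
proof -
  assume "D \<le> M"
  then have "restrict id {..<D} \<in> injections D M"
    by (auto simp: injections_def inj_on_def)
  then show ?thesis by (auto simp: card_gt_0_iff)
qed

text \<open>A map that is not injective identifies two positions \<open>k\<close> and
  \<open>l\<close>, and is then determined by its values away from \<open>l\<close>. There are at
  most \<open>D * D\<close> such pairs. Against all \<open>M ^ D\<close> maps this number is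
  negligible for large \<open>M\<close>.\<close>

lemma card_noninjective_le:
  "card (PiE {..<D} (\<lambda>_. {..<M}) - injections D M) \<le> D * D * M ^ (D - 1)"
proof -
  define X where "X k l = {\<iota> \<in> PiE {..<D} (\<lambda>_. {..<M}). \<iota> k = \<iota> l}" for k l :: nat
  have X: "card (X k l) \<le> M ^ (D - 1)" if "k < D" "l < D" "k \<noteq> l" for k l
  proof -
    have "card (X k l) \<le> card (PiE ({..<D} - {l}) (\<lambda>_. {..<M}))"
    proof (rule card_inj_on_le)
      show "inj_on (\<lambda>\<iota>. restrict \<iota> ({..<D} - {l})) (X k l)"
      proof (rule inj_onI)
        fix a b assume a: "a \<in> X k l" and b: "b \<in> X k l"
          and eq: "restrict a ({..<D} - {l}) = restrict b ({..<D} - {l})"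
        have *: "a i = b i" if "i < D" "i \<noteq> l" for i
          using fun_cong[OF eq, of i] that by simp
        show "a = b"
        proof
          fix i
          show "a i = b i"
            using a b *[of i] *[of k] that
            by (cases "i < D"; cases "i = l") (auto simp: X_def PiE_def extensional_def)
        qed
      qed
      show "(\<lambda>\<iota>. restrict \<iota> ({..<D} - {l})) ` X k l \<subseteq> PiE ({..<D} - {l}) (\<lambda>_. {..<M})"
        by (intro image_subsetI restrict_PiE_iff[THEN iffD2]) (auto simp: X_def PiE_iff)
      show "finite (PiE ({..<D} - {l}) (\<lambda>_. {..<M}))" by (rule finite_PiE) auto
    qed
    also have "\<dots> = M ^ (D - 1)" using that by (simp add: card_PiE)
    finally show ?thesis .
  qed
  let ?P = "{(k, l). k < D \<and> l < D \<and> k \<noteq> l}"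
  have fin: "finite ?P" by (rule finite_subset[of _ "{..<D} \<times> {..<D}"]) auto
  have "PiE {..<D} (\<lambda>_. {..<M}) - injections D M \<subseteq> (\<Union>(k, l)\<in>?P. X k l)"
    by (auto simp: injections_def X_def inj_on_def)
  moreover have "finite (X k l)" for k l by (simp add: X_def finite_PiE)
  ultimately have "card (PiE {..<D} (\<lambda>_. {..<M}) - injections D M) \<le> card (\<Union>(k, l)\<in>?P. X k l)"
    using fin by (intro card_mono) auto
  also have "\<dots> \<le> (\<Sum>(k, l)\<in>?P. card (X k l))"
    using card_UN_le[OF fin, of "\<lambda>(k, l). X k l"] by (simp add: case_prod_unfold)
  also have "\<dots> \<le> (\<Sum>(k, l)\<in>?P. M ^ (D - 1))"
    using X by (intro sum_mono) auto
  also have "\<dots> \<le> D * D * M ^ (D - 1)"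
    using card_mono[of "{..<D} \<times> {..<D}" ?P] by (auto intro!: mult_right_mono)
  finally show ?thesis .
qed

definition freq :: "nat \<Rightarrow> (nat \<Rightarrow> 'j) \<Rightarrow> real ^ 'j::finite" where
  "freq M w = (\<chi> j. card {m. m < M \<and> w m = j} / M)"

lemma freq_simplex:
  assumes "M > 0"
  shows "freq M w $ j \<ge> 0" "(\<Sum>j\<in>UNIV. freq M w $ j) = 1"
proof -
  show "freq M w $ j \<ge> 0" by (simp add: freq_def)
  have "(\<Sum>j\<in>UNIV. card {m. m < M \<and> w m = j}) = card (\<Union>j. {m. m < M \<and> w m = j})"
    by (subst card_UN_disjoint) auto
  also have "(\<Union>j. {m. m < M \<and> w m = j}) = {..<M}" by auto
  finally have "(\<Sum>j\<in>UNIV. real (card {m. m < M \<and> w m = j})) = M"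
    by (simp flip: of_nat_sum)
  then show "(\<Sum>j\<in>UNIV. freq M w $ j) = 1"
    using assms by (simp add: freq_def sum_divide_distrib[symmetric])
qed

text \<open>This counts the injective readings of \<open>v\<close> in \<open>w\<close>. Writing each
  count as a product of indicators lets the sum over all maps factor into letter counts.\<close>

definition occurrences :: "nat \<Rightarrow> nat \<Rightarrow> (nat \<Rightarrow> 'j) \<Rightarrow> (nat \<Rightarrow> 'j) \<Rightarrow> real" where
  "occurrences D M v w = (\<Sum>\<iota>\<in>injections D M. \<Prod>k<D. of_bool (w (\<iota> k) = v k))"

text \<open>Summed over all maps, the product of indicators factors into letter counts and gives
  exactly \<open>M ^ D\<close> times the product of frequencies. The maps that are not injective
  contribute at most 1 each.\<close>

lemma occurrences_freq:
  assumes "M > 0"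
  shows "\<bar>occurrences D M v w - real M ^ D * (\<Prod>k<D. freq M w $ v k)\<bar>
    \<le> card (PiE {..<D} (\<lambda>_. {..<M}) - injections D M)"
proof -
  let ?P = "PiE {..<D} (\<lambda>_. {..<M})"
  let ?h = "\<lambda>\<iota>. \<Prod>k<D. of_bool (w (\<iota> k) = v k) :: real"
  have "(\<Sum>m<M. of_bool (w m = j) :: real) = M * freq M w $ j" for j
  proof -
    have "(\<Sum>m<M. of_bool (w m = j) :: real) = card {m. m < M \<and> w m = j}"
      by (simp add: of_bool_def sum.If_cases Int_def)
    then show ?thesis using assms by (simp add: freq_def)
  qed
  then have "real M ^ D * (\<Prod>k<D. freq M w $ v k) = (\<Prod>k<D. \<Sum>m<M. of_bool (w m = v k))"
    by (simp add: prod.distrib)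
  also have "\<dots> = (\<Sum>\<iota>\<in>?P. ?h \<iota>)" by (subst prod_sum_PiE) auto
  also have "\<dots> = occurrences D M v w + (\<Sum>\<iota>\<in>?P - injections D M. ?h \<iota>)"
    unfolding occurrences_def
    by (subst sum.subset_diff[of "injections D M"]) (auto simp: injections_def finite_PiE)
  finally have "\<bar>occurrences D M v w - real M ^ D * (\<Prod>k<D. freq M w $ v k)\<bar> =
      \<bar>\<Sum>\<iota>\<in>?P - injections D M. ?h \<iota>\<bar>" by simp
  also have "\<dots> \<le> (\<Sum>\<iota>\<in>?P - injections D M. \<bar>?h \<iota>\<bar>)" by (rule sum_abs)
  also have "\<dots> \<le> (\<Sum>\<iota>\<in>?P - injections D M. 1)"
    unfolding abs_prod by (intro sum_mono prod_le_1) auto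
  finally show ?thesis by simp
qed

text \<open>The indicators fix the letters at the \<open>D\<close> distinct positions hit by
  \<open>\<iota>\<close>. The other \<open>M - D\<close> letters are free, and each contributes the
  full sum of \<open>y\<close>.\<close>

lemma sum_words_injection:
  fixes y :: "'j::finite \<Rightarrow> 'a::comm_semiring_1"
  assumes "\<iota> \<in> injections D M"
  shows "(\<Sum>w\<in>PiE {..<M} (\<lambda>_. UNIV). (\<Prod>m<M. y (w m)) * (\<Prod>k<D. of_bool (w (\<iota> k) = v k))) =
    (\<Sum>j\<in>UNIV. y j) ^ (M - D) * (\<Prod>k<D. y (v k))"
proof -
  have inj: "inj_on \<iota> {..<D}" and sub: "\<iota> ` {..<D} \<subseteq> {..<M}"
    using assms by (auto simp: injections_def)
  define r where "r = the_inv_into {..<D} \<iota>"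
  have r: "r (\<iota> k) = k" if "k < D" for k
    using inj that by (simp add: r_def the_inv_into_f_f)
  \<comment> \<open>The indicator belonging to \<open>k\<close> is moved to position
    \<open>\<iota> k\<close>, so that the summand becomes a product over positions and the sum over
    words factors.\<close>
  define h where "h m j = y j * (if m \<in> \<iota> ` {..<D} then of_bool (j = v (r m)) else 1)" for m j
  have split: "(\<Prod>m<M. if m \<in> \<iota> ` {..<D} then g m else c) = c ^ (M - D) * (\<Prod>k<D. g (\<iota> k))"
    for g :: "nat \<Rightarrow> 'a" and c
  proof -
    have "(\<Prod>m<M. if m \<in> \<iota> ` {..<D} then g m else c) =
        (\<Prod>m\<in>\<iota> ` {..<D}. g m) * (\<Prod>m\<in>{..<M} - \<iota> ` {..<D}. c)"
      using sub by (subst prod.If_cases) (auto simp: Int_absorb1 Diff_eq)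
    also have "\<dots> = c ^ (M - D) * (\<Prod>k<D. g (\<iota> k))"
      using sub inj by (simp add: prod.reindex card_Diff_subset card_image mult.commute)
    finally show ?thesis .
  qed
  have "(\<Prod>m<M. y (w m)) * (\<Prod>k<D. of_bool (w (\<iota> k) = v k)) = (\<Prod>m<M. h m (w m))" for w
    unfolding h_def prod.distrib split by (simp add: r)
  then have "(\<Sum>w\<in>PiE {..<M} (\<lambda>_. UNIV). (\<Prod>m<M. y (w m)) * (\<Prod>k<D. of_bool (w (\<iota> k) = v k))) =
      (\<Prod>m<M. \<Sum>j\<in>UNIV. h m j)"
    by (subst prod_sum_PiE) auto
  also have "\<dots> = (\<Prod>m<M. if m \<in> \<iota> ` {..<D} then y (v (r m)) else (\<Sum>j\<in>UNIV. y j))"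
    by (intro prod.cong) (auto simp: h_def of_bool_def if_distrib[of "(*) _"] cong: if_cong)
  also have "\<dots> = (\<Sum>j\<in>UNIV. y j) ^ (M - D) * (\<Prod>k<D. y (v k))"
    unfolding split by (simp add: r)
  finally show ?thesis .
qed

lemma PConst_of_bool: "PConst (of_bool b) = of_bool b"
  by (cases b) auto

lemma PConst_of_nat: "PConst (real n) = of_nat n"
  by (simp add: PConst_def)

text \<open>For a single monomial, \<open>sum_words_injection\<close> is summed over all injections;
  their number appears on the left to avoid a division. The bound \<open>B\<close> accumulates
  absolute values of coefficients and is independent of \<open>M\<close>.\<close>

lemma tform_words:
  assumes "tform y D f p"
  shows "\<exists>B\<ge>0 :: real. \<forall>M>0. \<exists>A.
    PConst (card (injections D M)) * (\<Sum>j\<in>UNIV. y j) ^ (M - D) * p =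
      (\<Sum>w\<in>PiE {..<M} (\<lambda>_. UNIV). PConst (A w) * (\<Prod>m<M. y (w m))) \<and>
    (\<forall>w. \<bar>A w - real M ^ D * f (freq M w)\<bar> \<le> B * card (PiE {..<D} (\<lambda>_. {..<M}) - injections D M))"
  using assms
proof induction
  case (monomial c v)
  show ?case
  proof (intro exI[of _ "\<bar>c\<bar>"] conjI allI impI)
    fix M :: nat assume M: "M > 0"
    let ?W = "PiE {..<M} (\<lambda>_. UNIV :: 'a set)"
    have "(\<Sum>w\<in>?W. PConst (occurrences D M v w) * (\<Prod>m<M. y (w m))) =
        (\<Sum>w\<in>?W. \<Sum>\<iota>\<in>injections D M. (\<Prod>m<M. y (w m)) * (\<Prod>k<D. of_bool (w (\<iota> k) = v k)))"
      unfolding occurrences_def PConst_sum PConst_prod PConst_of_bool sum_distrib_right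
      by (simp only: mult.commute)
    also have "\<dots> = (\<Sum>\<iota>\<in>injections D M. (\<Sum>j\<in>UNIV. y j) ^ (M - D) * (\<Prod>k<D. y (v k)))"
      by (subst sum.swap) (simp add: sum_words_injection)
    also have "\<dots> = PConst (card (injections D M)) * ((\<Sum>j\<in>UNIV. y j) ^ (M - D) * (\<Prod>k<D. y (v k)))"
      by (simp add: PConst_of_nat)
    finally have *: "(\<Sum>w\<in>?W. PConst (occurrences D M v w) * (\<Prod>m<M. y (w m))) =
      PConst (card (injections D M)) * ((\<Sum>j\<in>UNIV. y j) ^ (M - D) * (\<Prod>k<D. y (v k)))" .
    have "(\<Sum>w\<in>?W. PConst (c * occurrences D M v w) * (\<Prod>m<M. y (w m))) =
        PConst c * (\<Sum>w\<in>?W. PConst (occurrences D M v w) * (\<Prod>m<M. y (w m)))"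
      by (simp add: PConst_mult sum_distrib_left mult.assoc)
    moreover have "\<bar>c * occurrences D M v w - real M ^ D * (c * (\<Prod>k<D. freq M w $ v k))\<bar>
        \<le> \<bar>c\<bar> * card (PiE {..<D} (\<lambda>_. {..<M}) - injections D M)" for w
    proof -
      have "\<bar>c * occurrences D M v w - real M ^ D * (c * (\<Prod>k<D. freq M w $ v k))\<bar> =
          \<bar>c\<bar> * \<bar>occurrences D M v w - real M ^ D * (\<Prod>k<D. freq M w $ v k)\<bar>"
        by (simp add: abs_mult[symmetric] algebra_simps)
      also have "\<dots> \<le> \<bar>c\<bar> * card (PiE {..<D} (\<lambda>_. {..<M}) - injections D M)"
        by (intro mult_left_mono occurrences_freq M) auto
      finally show ?thesis .
    qed
    ultimately show "\<exists>A. PConst (card (injections D M)) * (\<Sum>j\<in>UNIV. y j) ^ (M - D) *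
        (PConst c * (\<Prod>k<D. y (v k))) = (\<Sum>w\<in>?W. PConst (A w) * (\<Prod>m<M. y (w m))) \<and>
      (\<forall>w. \<bar>A w - real M ^ D * (c * (\<Prod>k<D. freq M w $ v k))\<bar>
        \<le> \<bar>c\<bar> * card (PiE {..<D} (\<lambda>_. {..<M}) - injections D M))"
      unfolding *
      by (intro exI[of _ "\<lambda>w. c * occurrences D M v w"] conjI) (auto simp: ac_simps)
  qed simp
next
  case (add f p g r)
  let ?n = "\<lambda>M. card (PiE {..<D} (\<lambda>_. {..<M}) - injections D M)"
  obtain B :: real where B: "B \<ge> 0" "\<forall>M>0. \<exists>A.
    PConst (card (injections D M)) * (\<Sum>j\<in>UNIV. y j) ^ (M - D) * p =
      (\<Sum>w\<in>PiE {..<M} (\<lambda>_. UNIV). PConst (A w) * (\<Prod>m<M. y (w m))) \<and>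
    (\<forall>w. \<bar>A w - real M ^ D * f (freq M w)\<bar> \<le> B * ?n M)" using add.IH(1) by blast
  obtain B' :: real where B': "B' \<ge> 0" "\<forall>M>0. \<exists>A.
    PConst (card (injections D M)) * (\<Sum>j\<in>UNIV. y j) ^ (M - D) * r =
      (\<Sum>w\<in>PiE {..<M} (\<lambda>_. UNIV). PConst (A w) * (\<Prod>m<M. y (w m))) \<and>
    (\<forall>w. \<bar>A w - real M ^ D * g (freq M w)\<bar> \<le> B' * ?n M)" using add.IH(2) by blast
  show ?case
  proof (intro exI[of _ "B + B'"] conjI allI impI)
    show "0 \<le> B + B'" using B B' by simp
    fix M :: nat assume M: "M > 0"
    obtain A where A: "PConst (card (injections D M)) * (\<Sum>j\<in>UNIV. y j) ^ (M - D) * p =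
        (\<Sum>w\<in>PiE {..<M} (\<lambda>_. UNIV). PConst (A w) * (\<Prod>m<M. y (w m)))"
      "\<And>w. \<bar>A w - real M ^ D * f (freq M w)\<bar> \<le> B * ?n M" using B(2)[rule_format, OF M] by blast
    obtain A' where A': "PConst (card (injections D M)) * (\<Sum>j\<in>UNIV. y j) ^ (M - D) * r =
        (\<Sum>w\<in>PiE {..<M} (\<lambda>_. UNIV). PConst (A' w) * (\<Prod>m<M. y (w m)))"
      "\<And>w. \<bar>A' w - real M ^ D * g (freq M w)\<bar> \<le> B' * ?n M" using B'(2)[rule_format, OF M] by blast
    show "\<exists>A. PConst (card (injections D M)) * (\<Sum>j\<in>UNIV. y j) ^ (M - D) * (p + r) =
        (\<Sum>w\<in>PiE {..<M} (\<lambda>_. UNIV). PConst (A w) * (\<Prod>m<M. y (w m))) \<and>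
      (\<forall>w. \<bar>A w - real M ^ D * (f (freq M w) + g (freq M w))\<bar> \<le> (B + B') * ?n M)"
    proof (intro exI[of _ "\<lambda>w. A w + A' w"] conjI allI)
      show "PConst (card (injections D M)) * (\<Sum>j\<in>UNIV. y j) ^ (M - D) * (p + r) =
        (\<Sum>w\<in>PiE {..<M} (\<lambda>_. UNIV). PConst (A w + A' w) * (\<Prod>m<M. y (w m)))"
        by (simp add: distrib_left distrib_right A A' PConst_add sum.distrib)
      fix w
      show "\<bar>A w + A' w - real M ^ D * (f (freq M w) + g (freq M w))\<bar> \<le> (B + B') * ?n M"
        using A(2)[of w] A'(2)[of w] by (simp add: distrib_left distrib_right abs_le_iff)
    qed
  qed
qed

section \<open>Positive definite forms on the sphere\<close>

text \<open>The part \<open>B\<close> of \<open>K\<close> where \<open>g\<close> is not positive is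
  compact and \<open>Q\<close> has no zero on it, so \<open>Q\<close> is bounded below there by some
  \<open>m > 0\<close> and a large multiple of it outweighs \<open>g\<close>. Compactness of
  \<open>K\<close> then turns positivity into the uniform bound \<open>\<tau>\<close>.\<close>

lemma compact_penalty:
  fixes K :: "'a::metric_space set" and g Q :: "'a \<Rightarrow> real"
  assumes "compact K" and g: "continuous_on K g" and Q: "continuous_on K Q"
    and Q0: "\<And>p. p \<in> K \<Longrightarrow> Q p \<ge> 0" and pos: "\<And>p. p \<in> K \<Longrightarrow> Q p = 0 \<Longrightarrow> g p > 0"
  shows "\<exists>\<kappa>\<ge>0. \<exists>\<tau>>0. \<forall>p\<in>K. \<tau> \<le> g p + \<kappa> * Q p"
proof (cases "K = {}")
  case True
  then show ?thesis by (intro exI[of _ 0] conjI exI[of _ 1]) auto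
next
  case False
  define B where "B = K \<inter> g -` {..0}"
  have "compact B"
    using assms(1) continuous_closed_preimage[OF g compact_imp_closed[OF assms(1)], of "{..0}"]
    by (metis B_def closed_atMost compact_Int_closed inf.left_idem)
  have "\<exists>m>0. \<forall>p\<in>B. m \<le> Q p"
  proof (cases "B = {}")
    case True
    then show ?thesis by (intro exI[of _ 1]) auto
  next
    case False
    obtain p where p: "p \<in> B" "\<forall>p'\<in>B. Q p \<le> Q p'"
      using continuous_attains_inf[OF \<open>compact B\<close> False] continuous_on_subset[OF Q, of B]
      by (auto simp: B_def)
    then have "0 < Q p" using Q0[of p] pos[of p] by (force simp: B_def)
    then show ?thesis using p by blast
  qed
  then obtain m where m: "m > 0" "\<And>p. p \<in> B \<Longrightarrow> m \<le> Q p" by blast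
  obtain p0 where p0: "p0 \<in> K" "\<forall>p\<in>K. g p0 \<le> g p"
    using continuous_attains_inf[OF assms(1) False g] by blast
  \<comment> \<open>With \<open>g p0\<close> the minimum of \<open>g\<close>, this choice makes
    \<open>\<kappa> * m\<close> exceed \<open>- g p\<close> everywhere on \<open>K\<close>.\<close>
  define \<kappa> where "\<kappa> = (\<bar>g p0\<bar> + 1) / m"
  have \<kappa>: "\<kappa> \<ge> 0" using m(1) by (simp add: \<kappa>_def)
  have gt: "0 < g p + \<kappa> * Q p" if p: "p \<in> K" for p
  proof (cases "p \<in> B")
    case True
    have "\<kappa> * m \<le> \<kappa> * Q p" using m(2)[OF True] \<kappa> by (rule mult_left_mono)
    then show ?thesis using p0(2) p m(1) by (fastforce simp: \<kappa>_def)
  next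
    case False
    then show ?thesis using p \<kappa> Q0[OF p] by (simp add: B_def add_pos_nonneg)
  qed
  have "continuous_on K (\<lambda>p. g p + \<kappa> * Q p)" by (intro continuous_intros g Q)
  then obtain p1 where "p1 \<in> K" "\<forall>p\<in>K. g p1 + \<kappa> * Q p1 \<le> g p + \<kappa> * Q p"
    using continuous_attains_inf[OF assms(1) False] by blast
  then show ?thesis using \<kappa> gt[of p1] by blast
qed

section \<open>Polya's theorem for matrix coefficients\<close>

lemma square_in_sos: "p ^ 2 \<in> sos"
  unfolding sos_def by (rule finite_sums_base) blast

lemma inner_matrix_sum: "v \<bullet> (A *v w) = (\<Sum>i\<in>UNIV. \<Sum>j\<in>UNIV. v $ i * A $ i $ j * w $ j)"
  for v w :: "real ^ 't::finite"
  by (simp add: inner_vec_def matrix_vector_mult_def sum_distrib_left mult.assoc)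

text \<open>Up to the factor counting injections, the coefficient at a word is \<open>M ^ D\<close>
  times the form at its letter frequencies, which contributes at least
  \<open>\<tau> * M ^ D\<close>, with an error of order \<open>M ^ (D - 1)\<close>. For large
  \<open>M\<close> all coefficients are positive semidefinite, and they multiply squares of products
  of the \<open>ell j\<close>.\<close>

lemma matrix_polya:
  fixes F :: "('n::finite, 't::finite) pmat" and ell :: "'j::finite \<Rightarrow> 'n rpoly"
  assumes tf: "\<And>i j. tform (\<lambda>j. (ell j)\<^sup>2) D (f i j) (F $ i $ j)"
    and F: "symmetric_mat F" and sum: "(\<Sum>j\<in>UNIV. (ell j)\<^sup>2) = sigma" and "\<tau> > 0"
    and pos: "\<And>q v. (\<And>j. 0 \<le> q $ j) \<Longrightarrow> (\<Sum>j\<in>UNIV. q $ j) = 1 \<Longrightarrow>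
      \<tau> * (norm v)\<^sup>2 \<le> (\<Sum>i\<in>UNIV. \<Sum>j\<in>UNIV. v $ i * f i j q * v $ j)"
  shows "\<exists>N. pscale (sigma ^ N) F \<in> qm_lift sos"
proof -
  let ?n = "\<lambda>M. card (PiE {..<D} (\<lambda>_. {..<M}) - injections D M)"
  let ?W = "\<lambda>M. PiE {..<M} (\<lambda>_. UNIV :: 'j set)"
  define good where "good i j B M A \<longleftrightarrow>
    PConst (card (injections D M)) * sigma ^ (M - D) * F $ i $ j =
      (\<Sum>w\<in>?W M. PConst (A w) * (\<Prod>m<M. (ell (w m))\<^sup>2)) \<and>
    (\<forall>w. \<bar>A w - real M ^ D * f i j (freq M w)\<bar> \<le> B * ?n M)" for i j and B :: real and M A
  have "\<forall>i j. \<exists>B\<ge>0. \<forall>M>0. \<exists>A. good i j B M A"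
    using tform_words[OF tf] unfolding sum good_def by blast
  then obtain B where B: "\<And>i j. 0 \<le> B i j"
    and words: "\<And>i j M. M > 0 \<Longrightarrow> \<exists>A. good i j (B i j) M A"
    by metis
  define B0 where "B0 = (\<Sum>i\<in>UNIV. \<Sum>j\<in>UNIV. B i j)"
  have B0: "B0 \<ge> 0" unfolding B0_def by (intro sum_nonneg B)
  obtain M0 :: nat where M0: "B0 * D * D / \<tau> \<le> M0" using real_arch_simple by blast
  \<comment> \<open>Besides beating the error term, \<open>M\<close> must be positive and at least
    \<open>D\<close>, so that injections exist.\<close>
  define M where "M = M0 + D + 1"
  have M: "M > 0" "D \<le> M" by (auto simp: M_def)
  have "B0 * D * D / \<tau> \<le> M" using M0 by (simp add: M_def)
  then have M_large: "B0 * D * D \<le> \<tau> * M"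
    using \<open>\<tau> > 0\<close> by (simp add: field_simps)
  obtain A where good: "\<And>i j. good i j (B i j) M (A i j)"
    using words[OF M(1)] by metis
  have A: "PConst (card (injections D M)) * sigma ^ (M - D) * F $ i $ j =
      (\<Sum>w\<in>?W M. PConst (A i j w) * (\<Prod>m<M. (ell (w m))\<^sup>2))"
    and A_bound: "\<bar>A i j w - real M ^ D * f i j (freq M w)\<bar> \<le> B i j * ?n M" for i j w
    using good[of i j] by (auto simp: good_def)
  define c where "c = real (card (injections D M))"
  have c: "c > 0" using card_injections_pos[OF M(2)] by (simp add: c_def)
  \<comment> \<open>The coefficients of each entry are chosen separately and may fail to be
    symmetric in \<open>i\<close> and \<open>j\<close>; averaging repairs this. Dividing by
    \<open>c\<close> undoes the factor that counts injections.\<close>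
  define S where "S w = (\<chi> i j. (A i j w + A j i w) / (2 * c))" for w
  have n_bound: "B0 * ?n M \<le> \<tau> * real M ^ D"
  proof -
    have "real (?n M) \<le> real (D * D * M ^ (D - 1))"
      using card_noninjective_le[of D M] by (simp only: of_nat_le_iff)
    then have "B0 * ?n M \<le> B0 * real (D * D * M ^ (D - 1))" using B0 by (rule mult_left_mono)
    also have "\<dots> = B0 * D * D * real M ^ (D - 1)" by simp
    also have "\<dots> \<le> \<tau> * real M ^ D"
    \<comment> \<open>For \<open>D = 0\<close> the exponent \<open>D - 1\<close> is truncated to 0,
      but the factor \<open>D\<close> makes the left side vanish.\<close>
    proof (cases D)
      case (Suc k)
      have "B0 * D * D * real M ^ k \<le> \<tau> * M * real M ^ k"
        using M_large by (rule mult_right_mono) simp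
      then show ?thesis by (simp add: Suc mult.assoc)
    qed (use \<open>\<tau> > 0\<close> in simp)
    finally show ?thesis .
  qed
  have "psd (S w)" for w
    unfolding psd_def
  proof (intro conjI allI)
    show "symmetric_mat (S w)" by (simp add: S_def symmetric_mat_iff add.commute)
    fix v :: "real ^ 't"
    let ?q = "freq M w"
    have "\<bar>\<Sum>i\<in>UNIV. \<Sum>j\<in>UNIV. v $ i * (A i j w - real M ^ D * f i j ?q) * v $ j\<bar> \<le>
        (\<Sum>i\<in>UNIV. \<Sum>j\<in>UNIV. \<bar>v $ i * (A i j w - real M ^ D * f i j ?q) * v $ j\<bar>)"
      by (rule order_trans[OF sum_abs sum_mono[OF sum_abs]])
    also have "\<dots> \<le> (\<Sum>i\<in>UNIV. \<Sum>j\<in>UNIV. norm v * (B i j * ?n M) * norm v)"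
      unfolding abs_mult
      by (intro sum_mono mult_mono A_bound component_le_norm_cart mult_nonneg_nonneg B) auto
    also have "\<dots> = B0 * ?n M * (norm v)\<^sup>2"
      by (simp add: B0_def sum_distrib_right sum_distrib_left power2_eq_square ac_simps)
    also have "\<dots> \<le> \<tau> * real M ^ D * (norm v)\<^sup>2"
      using n_bound by (rule mult_right_mono) simp
    finally have *: "\<bar>\<Sum>i\<in>UNIV. \<Sum>j\<in>UNIV. v $ i * (A i j w - real M ^ D * f i j ?q) * v $ j\<bar>
      \<le> \<tau> * real M ^ D * (norm v)\<^sup>2" .
    have "real M ^ D * (\<tau> * (norm v)\<^sup>2) \<le>
        real M ^ D * (\<Sum>i\<in>UNIV. \<Sum>j\<in>UNIV. v $ i * f i j ?q * v $ j)"
      using pos[of ?q v] freq_simplex[OF M(1), of w] by (intro mult_left_mono) auto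
    moreover have "(\<Sum>i\<in>UNIV. \<Sum>j\<in>UNIV. v $ i * (A i j w - real M ^ D * f i j ?q) * v $ j) =
        (\<Sum>i\<in>UNIV. \<Sum>j\<in>UNIV. v $ i * A i j w * v $ j) -
        real M ^ D * (\<Sum>i\<in>UNIV. \<Sum>j\<in>UNIV. v $ i * f i j ?q * v $ j)"
      by (simp add: sum_subtractf sum_distrib_left algebra_simps)
    ultimately have nonneg: "0 \<le> (\<Sum>i\<in>UNIV. \<Sum>j\<in>UNIV. v $ i * A i j w * v $ j)"
      using * by (simp add: ac_simps abs_le_iff)
    have swap: "(\<Sum>i\<in>UNIV. \<Sum>j\<in>UNIV. v $ i * A j i w * v $ j) =
        (\<Sum>i\<in>UNIV. \<Sum>j\<in>UNIV. v $ i * A i j w * v $ j)"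
      by (subst sum.swap) (simp add: ac_simps)
    have "2 * c * (v \<bullet> (S w *v v)) = (\<Sum>i\<in>UNIV. \<Sum>j\<in>UNIV. v $ i * (A i j w + A j i w) * v $ j)"
      unfolding inner_matrix_sum sum_distrib_left
      using c by (intro sum.cong refl) (simp add: S_def)
    also have "\<dots> = 2 * (\<Sum>i\<in>UNIV. \<Sum>j\<in>UNIV. v $ i * A i j w * v $ j)"
      using swap by (simp add: distrib_left distrib_right sum.distrib)
    finally have "0 \<le> 2 * c * (v \<bullet> (S w *v v))" using nonneg by simp
    then show "0 \<le> v \<bullet> (S w *v v)" using c by (simp add: zero_le_mult_iff)
  qed
  then have "pscale ((\<Prod>m<M. ell (w m))\<^sup>2) (map_matrix PConst (S w)) \<in> qm_lift sos" for w
    by (intro qm_lift_psd square_in_sos)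
  then have "(\<Sum>w\<in>?W M. pscale ((\<Prod>m<M. ell (w m))\<^sup>2) (map_matrix PConst (S w))) \<in> qm_lift sos"
    by (intro qm_lift_sum)
  also have "(\<Sum>w\<in>?W M. pscale ((\<Prod>m<M. ell (w m))\<^sup>2) (map_matrix PConst (S w))) =
      pscale (sigma ^ (M - D)) F"
  proof -
    have "(\<Sum>w\<in>?W M. (\<Prod>m<M. ell (w m))\<^sup>2 * PConst (S w $ i $ j)) = sigma ^ (M - D) * F $ i $ j" for i j
    proof -
      have "(\<Sum>w\<in>?W M. (\<Prod>m<M. ell (w m))\<^sup>2 * PConst (S w $ i $ j)) =
          PConst (1 / (2 * c)) * (\<Sum>w\<in>?W M. PConst (A i j w) * (\<Prod>m<M. (ell (w m))\<^sup>2)) +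
          PConst (1 / (2 * c)) * (\<Sum>w\<in>?W M. PConst (A j i w) * (\<Prod>m<M. (ell (w m))\<^sup>2))"
        unfolding sum_distrib_left sum.distrib[symmetric]
      proof (rule sum.cong[OF refl])
        fix w
        have "S w $ i $ j = 1 / (2 * c) * A i j w + 1 / (2 * c) * A j i w"
          by (simp add: S_def add_divide_distrib)
        then have S: "PConst (S w $ i $ j) = PConst (1 / (2 * c)) * PConst (A i j w) +
            PConst (1 / (2 * c)) * (PConst (A j i w) :: 'n rpoly)"
          by (simp only: PConst_add PConst_mult)
        show "(\<Prod>m<M. ell (w m))\<^sup>2 * PConst (S w $ i $ j) =
            PConst (1 / (2 * c)) * (PConst (A i j w) * (\<Prod>m<M. (ell (w m))\<^sup>2)) +
            PConst (1 / (2 * c)) * (PConst (A j i w) * (\<Prod>m<M. (ell (w m))\<^sup>2))"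
          unfolding S prod_power_distrib by (simp add: distrib_left ac_simps)
      qed
      also have "\<dots> = PConst (1 / (2 * c) * c + 1 / (2 * c) * c) * (sigma ^ (M - D) * F $ i $ j)"
        using F unfolding A[symmetric] c_def[symmetric]
        by (simp only: PConst_add PConst_mult symmetric_mat_iff) (simp add: distrib_right mult.assoc)
      also have "1 / (2 * c) * c + 1 / (2 * c) * c = 1" using c by simp
      finally show ?thesis by simp
    qed
    then show ?thesis by (simp add: vec_eq_iff)
  qed
  finally show ?thesis by blast
qed

section \<open>Coordinates for products of two variables\<close>

text \<open>The squares of the linear forms \<open>gen\<close> sum to \<open>sigma\<close>, and \<open>X\<^sub>i X\<^sub>j\<close> is a linear combination of them,
  with real counterpart \<open>rank1 i j\<close>. Values \<open>q\<close> outside the image of the sphere are detected by \<open>penalty\<close>,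
  whose polynomial counterpart is zero.\<close>

definition gen :: "'n \<times> 'n \<times> bool \<Rightarrow> 'n::finite rpoly" where
  "gen = (\<lambda>(i, j, b). PConst (1 / (2 * sqrt CARD('n))) *
    (if b then PVar i + PVar j else PVar i - PVar j))"

lemma gen_power2:
  "(gen (i, j, b) :: 'n::finite rpoly)\<^sup>2 = PConst (1 / (4 * real CARD('n))) *
    (if b then (PVar i + PVar j)\<^sup>2 else (PVar i - PVar j)\<^sup>2)"
  by (simp add: gen_def power_mult_distrib PConst_power[symmetric] power_divide)

text \<open>By the parallelogram law the two signs for a pair \<open>(i, j)\<close> add up to twice
  the sum of the two squares. Over all pairs this is \<open>4 * n\<close> times
  \<open>sigma\<close>, with \<open>n = CARD('n)\<close>, which the normalisation cancels.\<close>

lemma sum_gen_power2: "(\<Sum>k\<in>UNIV. (gen k)\<^sup>2) = (sigma :: 'n::finite rpoly)"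
proof -
  have sq: "(a + b)\<^sup>2 + (a - b)\<^sup>2 = 2 * a\<^sup>2 + 2 * b\<^sup>2" for a b :: "'n rpoly"
    by (simp add: power2_eq_square algebra_simps)
  let ?c = "PConst (1 / (4 * real CARD('n))) :: 'n rpoly"
  have "(\<Sum>k\<in>UNIV. (gen k)\<^sup>2) = (\<Sum>i\<in>UNIV. \<Sum>j\<in>UNIV. \<Sum>b\<in>UNIV. (gen (i, j, b) :: 'n rpoly)\<^sup>2)"
    unfolding UNIV_Times_UNIV[symmetric] sum.cartesian_product by (simp add: case_prod_unfold)
  also have "\<dots> = (\<Sum>i\<in>UNIV. \<Sum>j\<in>UNIV. ?c * (2 * (PVar i)\<^sup>2 + 2 * (PVar j)\<^sup>2))"
  proof (intro sum.cong refl)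
    fix i j :: 'n
    have "(\<Sum>b\<in>UNIV. (gen (i, j, b))\<^sup>2) = ?c * ((PVar i + PVar j)\<^sup>2 + (PVar i - PVar j)\<^sup>2)"
      by (simp add: UNIV_bool gen_power2 distrib_left add.commute)
    then show "(\<Sum>b\<in>UNIV. (gen (i, j, b))\<^sup>2) = ?c * (2 * (PVar i)\<^sup>2 + 2 * (PVar j)\<^sup>2)"
      by (simp only: sq)
  qed
  also have "\<dots> = ?c * (\<Sum>i\<in>UNIV. \<Sum>j\<in>(UNIV :: 'n set). 2 * (PVar i)\<^sup>2 + 2 * (PVar j)\<^sup>2)"
    by (simp only: sum_distrib_left)
  also have "(\<Sum>i\<in>UNIV. \<Sum>j\<in>(UNIV :: 'n set). 2 * (PVar i)\<^sup>2 + 2 * (PVar j)\<^sup>2) =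
      4 * of_nat CARD('n) * (sigma :: 'n rpoly)"
    by (simp add: sum.distrib sigma_def flip: sum_distrib_left)
  also have "4 * of_nat CARD('n) = (PConst (4 * real CARD('n)) :: 'n rpoly)"
    by (simp add: PConst_mult PConst_of_nat) (simp add: PConst_def)
  also have "?c * (PConst (4 * real CARD('n)) * sigma) = PConst (1 / (4 * real CARD('n)) * (4 * real CARD('n))) * sigma"
    by (simp only: PConst_mult mult.assoc)
  finally show ?thesis by simp
qed

definition rank1 :: "'n::finite \<Rightarrow> 'n \<Rightarrow> real ^ ('n \<times> 'n \<times> bool) \<Rightarrow> real" where
  "rank1 i j q = real CARD('n) * (q $ (i, j, True) - q $ (i, j, False))"

lemma tform_rank1: "tform (\<lambda>k. (gen k)\<^sup>2) 1 (rank1 i j) (PVar i * PVar j :: 'n::finite rpoly)"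
proof -
  have sq: "(a + b)\<^sup>2 - (a - b)\<^sup>2 = 4 * (a * b)" for a b :: "'n rpoly"
    by (simp add: power2_eq_square algebra_simps)
  have four: "(4 :: 'n rpoly) = PConst 4" by (simp add: PConst_def)
  have "PConst (real CARD('n)) * ((gen (i, j, True))\<^sup>2 - (gen (i, j, False))\<^sup>2) =
      PConst (real CARD('n)) * (PConst (1 / (4 * real CARD('n))) * (4 * (PVar i * PVar j :: 'n rpoly)))"
    by (simp add: gen_power2 right_diff_distrib[symmetric] sq)
  also have "\<dots> = PConst (real CARD('n) * (1 / (4 * real CARD('n)) * 4)) * (PVar i * PVar j)"
    by (simp only: PConst_mult four mult.assoc)
  also have "\<dots> = PVar i * PVar j" by simp
  finally have "PConst (real CARD('n)) * ((gen (i, j, True))\<^sup>2 - (gen (i, j, False))\<^sup>2) =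
    (PVar i * PVar j :: 'n rpoly)" .
  moreover have "tform (\<lambda>k. (gen k)\<^sup>2) 1
      (\<lambda>q. real CARD('n) * (q $ (i, j, True) - q $ (i, j, False)))
      (PConst (real CARD('n)) * ((gen (i, j, True))\<^sup>2 - (gen (i, j, False))\<^sup>2))"
    by (intro tform_cmult tform_diff tform_var)
  ultimately show ?thesis by (simp add: rank1_def[abs_def])
qed

definition penalty :: "real ^ ('n::finite \<times> 'n \<times> bool) \<Rightarrow> real" where
  "penalty q =
    (\<Sum>i\<in>UNIV. \<Sum>k\<in>UNIV. \<Sum>l\<in>UNIV. (rank1 i i q * rank1 k l q - rank1 i k q * rank1 i l q)\<^sup>2) +
    ((\<Sum>i\<in>UNIV. rank1 i i q) - (\<Sum>k\<in>UNIV. q $ k))\<^sup>2 * (\<Sum>k\<in>UNIV. q $ k)\<^sup>2"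

lemma tform_sigma: "tform (\<lambda>k. (gen k)\<^sup>2) 1 (\<lambda>q. \<Sum>k\<in>UNIV. q $ k) (sigma :: 'n::finite rpoly)"
  unfolding sum_gen_power2[symmetric] by (intro tform_sum tform_var)

text \<open>After substitution every minor vanishes by commutativity, and the trace agrees with
  \<open>sigma\<close>. The factor \<open>(\<Sum>k\<in>UNIV. q $ k)\<^sup>2\<close>, which is 1 on
  the simplex, brings the trace term to degree 4 like the minors.\<close>

lemma tform_penalty: "tform (\<lambda>k. (gen k)\<^sup>2) 4 penalty (0 :: 'n::finite rpoly)"
proof -
  let ?y = "\<lambda>k. (gen k :: 'n rpoly)\<^sup>2"
  have "tform ?y (2 * (1 + 1)) (\<lambda>q. (rank1 i i q * rank1 k l q - rank1 i k q * rank1 i l q)\<^sup>2)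
      (((PVar i * PVar i) * (PVar k * PVar l) - (PVar i * PVar k) * (PVar i * PVar l))\<^sup>2)" for i k l
    by (intro tform_power tform_diff tform_mult tform_rank1)
  then have 1: "tform ?y 4 (\<lambda>q. (rank1 i i q * rank1 k l q - rank1 i k q * rank1 i l q)\<^sup>2) 0" for i k l
    by (simp add: ac_simps numeral_eq_Suc)
  have "tform ?y (2 * 1 + 2 * 1)
      (\<lambda>q. ((\<Sum>i\<in>UNIV. rank1 i i q) - (\<Sum>k\<in>UNIV. q $ k))\<^sup>2 * (\<Sum>k\<in>UNIV. q $ k)\<^sup>2)
      (((\<Sum>i\<in>UNIV. PVar i * PVar i) - sigma)\<^sup>2 * sigma\<^sup>2)"
    by (intro tform_mult tform_power tform_diff tform_sum tform_rank1 tform_sigma)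
  then have 2: "tform ?y 4
      (\<lambda>q. ((\<Sum>i\<in>UNIV. rank1 i i q) - (\<Sum>k\<in>UNIV. q $ k))\<^sup>2 * (\<Sum>k\<in>UNIV. q $ k)\<^sup>2) 0"
    by (simp add: sigma_def power2_eq_square)
  have "tform ?y 4 (\<lambda>q. \<Sum>i\<in>UNIV. \<Sum>k\<in>UNIV. \<Sum>l\<in>UNIV.
      (rank1 i i q * rank1 k l q - rank1 i k q * rank1 i l q)\<^sup>2)
      (\<Sum>i\<in>(UNIV :: 'n set). \<Sum>k\<in>(UNIV :: 'n set). \<Sum>l\<in>(UNIV :: 'n set). 0)"
    by (intro tform_sum 1)
  from tform.add[OF this 2] show ?thesis by (simp add: penalty_def[abs_def])
qed

lemma penalty_nonneg: "penalty q \<ge> 0"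
  unfolding penalty_def by (intro add_nonneg_nonneg sum_nonneg mult_nonneg_nonneg) auto

text \<open>The trace is 1, so some diagonal entry is positive. The vanishing minors through it make
  the matrix \<open>rank1 i j q\<close> the outer square of its normalised row, and the trace gives
  the norm.\<close>

lemma penalty_eq_0:
  fixes q :: "real ^ ('n::finite \<times> 'n \<times> bool)"
  assumes "penalty q = 0" "(\<Sum>k\<in>UNIV. q $ k) = 1"
  shows "\<exists>x. norm x = 1 \<and> (\<forall>i j. rank1 i j q = x $ i * x $ j)"
proof -
  let ?A = "\<Sum>i\<in>UNIV. \<Sum>k\<in>UNIV. \<Sum>l\<in>UNIV. (rank1 i i q * rank1 k l q - rank1 i k q * rank1 i l q)\<^sup>2"
  have "?A \<ge> 0" by (intro sum_nonneg) auto
  then have A: "?A = 0" and tr: "(\<Sum>i\<in>UNIV. rank1 i i q) = 1"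
    using assms zero_le_power2[of "(\<Sum>i\<in>UNIV. rank1 i i q) - 1"]
    unfolding penalty_def by (auto simp: add_nonneg_eq_0_iff)
  have "\<forall>i k l. rank1 i i q * rank1 k l q = rank1 i k q * rank1 i l q"
    using A by (simp add: sum_nonneg_eq_0_iff sum_nonneg)
  then have minor: "rank1 i i q * rank1 k l q = rank1 i k q * rank1 i l q" for i k l by blast
  obtain i where i: "rank1 i i q > 0"
  proof (rule ccontr)
    assume "\<not> thesis"
    then have "(\<Sum>i\<in>UNIV. rank1 i i q) \<le> 0" using that by (intro sum_nonpos) (meson not_le)
    then show False using tr by simp
  qed
  define x where "x = (\<chi> k. rank1 i k q / sqrt (rank1 i i q))"
  have x: "rank1 k l q = x $ k * x $ l" for k l
    using minor[of i k l] i by (simp add: x_def field_simps)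
  have "(norm x)\<^sup>2 = (\<Sum>k\<in>UNIV. rank1 k k q)"
    by (simp add: norm_vec_def L2_set_def sum_nonneg x power2_eq_square)
  then have "norm x = 1" using tr norm_ge_zero[of x] by (simp add: power2_eq_1_iff)
  then show ?thesis using x by blast
qed

section \<open>Even forms rewritten in the squares\<close>

lemma total_deg_SucD:
  assumes "total_deg \<alpha> = Suc m"
  shows "\<exists>i \<beta>. \<alpha> = Poly_Mapping.single i 1 + \<beta> \<and> total_deg \<beta> = m"
proof -
  obtain i where i: "Poly_Mapping.lookup \<alpha> i \<noteq> 0"
    using assms by (metis total_deg_def sum.neutral nat.distinct(1))
  define \<beta> where "\<beta> = \<alpha> - Poly_Mapping.single i 1"
  have \<alpha>: "\<alpha> = Poly_Mapping.single i 1 + \<beta>"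
    using i by (intro poly_mapping_eqI)
      (auto simp: \<beta>_def lookup_add lookup_minus lookup_single when_def)
  have "total_deg (Poly_Mapping.single i 1) = 1"
    by (simp add: total_deg_def lookup_single when_def)
  then have "total_deg \<beta> = m" using assms by (subst (asm) \<alpha>) (simp add: total_deg_add)
  then show ?thesis using \<alpha> by blast
qed

text \<open>Variables are split off two at a time, each pair becoming some \<open>rank1 i j\<close>,
  so degree \<open>2 * D\<close> turns into degree \<open>D\<close>. The pairing is arbitrary, but
  its value is determined wherever \<open>rank1 i j q\<close> equals
  \<open>x $ i * x $ j\<close>.\<close>

lemma tform_monomial_ex:
  assumes "total_deg \<alpha> = 2 * D"
  shows "\<exists>f. tform (\<lambda>k. (gen k)\<^sup>2) D f (Poly_Mapping.single \<alpha> c) \<and>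
    (\<forall>q x. (\<forall>i j. rank1 i j q = x $ i * x $ j) \<longrightarrow> f q = eval_poly x (Poly_Mapping.single \<alpha> c))"
  using assms
proof (induction D arbitrary: \<alpha>)
  case 0
  then have "\<alpha> = 0" by (intro poly_mapping_eqI) (simp add: total_deg_def)
  then show ?case
    by (intro exI[of _ "\<lambda>q. c"]) (use tform_const[of _ c] in \<open>simp add: PConst_def eval_poly_single\<close>)
next
  case (Suc D)
  obtain i \<beta> where \<beta>: "\<alpha> = Poly_Mapping.single i 1 + \<beta>" "total_deg \<beta> = Suc (2 * D)"
    using total_deg_SucD[of \<alpha> "Suc (2 * D)"] Suc.prems by auto
  obtain j \<gamma> where \<gamma>: "\<beta> = Poly_Mapping.single j 1 + \<gamma>" "total_deg \<gamma> = 2 * D"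
    using total_deg_SucD[OF \<beta>(2)] by blast
  have eq: "Poly_Mapping.single \<alpha> c = (PVar i * PVar j) * Poly_Mapping.single \<gamma> c"
    by (simp add: PVar_def mult_single \<beta>(1) \<gamma>(1) add.assoc)
  obtain f where f: "tform (\<lambda>k. (gen k)\<^sup>2) D f (Poly_Mapping.single \<gamma> c)"
    "\<And>q x. (\<forall>i j. rank1 i j q = x $ i * x $ j) \<Longrightarrow> f q = eval_poly x (Poly_Mapping.single \<gamma> c)"
    using Suc.IH[OF \<gamma>(2)] by blast
  show ?case
    using tform_mult[OF tform_rank1[of i j] f(1)] f(2)
    by (intro exI[of _ "\<lambda>q. rank1 i j q * f q"]) (simp add: eq eval_poly_mult)
qed

lemma tform_homogeneous_ex:
  assumes "homogeneous_poly (2 * D) p"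
  shows "\<exists>f. tform (\<lambda>k. (gen k)\<^sup>2) D f p \<and>
    (\<forall>q x. (\<forall>i j. rank1 i j q = x $ i * x $ j) \<longrightarrow> f q = eval_poly x p)"
proof -
  have "\<forall>\<alpha>\<in>Poly_Mapping.keys p. \<exists>f.
      tform (\<lambda>k. (gen k)\<^sup>2) D f (Poly_Mapping.single \<alpha> (Poly_Mapping.lookup p \<alpha>)) \<and>
      (\<forall>q x. (\<forall>i j. rank1 i j q = x $ i * x $ j) \<longrightarrow>
        f q = eval_poly x (Poly_Mapping.single \<alpha> (Poly_Mapping.lookup p \<alpha>)))"
    using assms tform_monomial_ex unfolding homogeneous_poly_iff_keys by blast
  from bchoice[OF this] obtain f where f: "\<And>\<alpha>. \<alpha> \<in> Poly_Mapping.keys p \<Longrightarrow>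
      tform (\<lambda>k. (gen k)\<^sup>2) D (f \<alpha>) (Poly_Mapping.single \<alpha> (Poly_Mapping.lookup p \<alpha>))"
    "\<And>\<alpha> q x. \<alpha> \<in> Poly_Mapping.keys p \<Longrightarrow> (\<forall>i j. rank1 i j q = x $ i * x $ j) \<Longrightarrow>
      f \<alpha> q = eval_poly x (Poly_Mapping.single \<alpha> (Poly_Mapping.lookup p \<alpha>))"
    by blast
  have "tform (\<lambda>k. (gen k)\<^sup>2) D (\<lambda>q. \<Sum>\<alpha>\<in>Poly_Mapping.keys p. f \<alpha> q)
      (\<Sum>\<alpha>\<in>Poly_Mapping.keys p. Poly_Mapping.single \<alpha> (Poly_Mapping.lookup p \<alpha>))"
    by (intro tform_sum f(1))
  then have "tform (\<lambda>k. (gen k)\<^sup>2) D (\<lambda>q. \<Sum>\<alpha>\<in>Poly_Mapping.keys p. f \<alpha> q) p"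
    by (simp flip: poly_mapping_sum_single)
  moreover have "(\<Sum>\<alpha>\<in>Poly_Mapping.keys p. f \<alpha> q) = eval_poly x p"
    if "\<forall>i j. rank1 i j q = x $ i * x $ j" for q x
  proof -
    have "(\<Sum>\<alpha>\<in>Poly_Mapping.keys p. f \<alpha> q) = eval_poly x
        (\<Sum>\<alpha>\<in>Poly_Mapping.keys p. Poly_Mapping.single \<alpha> (Poly_Mapping.lookup p \<alpha>))"
      unfolding eval_poly_sum using f(2)[OF _ that] by (intro sum.cong) auto
    then show ?thesis by (simp flip: poly_mapping_sum_single)
  qed
  ultimately show ?thesis by blast
qed

section \<open>Positive definiteness on the unit sphere\<close>

lemma compact_simplex: "compact {q :: real ^ 'j::finite. (\<forall>j. 0 \<le> q $ j) \<and> (\<Sum>j\<in>UNIV. q $ j) = 1}"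
proof -
  have "closed {q :: real ^ 'j. (\<forall>j. 0 \<le> q $ j) \<and> (\<Sum>j\<in>UNIV. q $ j) = 1}"
    by (intro closed_Collect_conj closed_Collect_all closed_Collect_le closed_Collect_eq
        continuous_intros)
  moreover have "norm q \<le> 1" if "\<forall>j. 0 \<le> q $ j" "(\<Sum>j\<in>UNIV. q $ j) = 1" for q :: "real ^ 'j"
    using norm_le_l1_cart[of q] that by simp
  ultimately show ?thesis by (auto simp: compact_eq_bounded_closed intro!: boundedI)
qed

text \<open>Where the penalty vanishes on the simplex, the rewritten form takes a value of
  \<open>F\<close> at a unit vector and is positive definite. So \<open>compact_penalty\<close>
  applies on the product of the simplex and the unit sphere of vectors \<open>v\<close>, and
  \<open>matrix_polya\<close> to the penalised form.\<close>

lemma positive_on_sphere: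
  fixes F :: "('n::finite, 't::finite) pmat"
  assumes "symmetric_mat F" "homogeneous_pmat (2 * D) F"
    and pos: "\<And>x v. norm x = 1 \<Longrightarrow> norm v = 1 \<Longrightarrow> v \<bullet> (eval_pmat x F *v v) > 0"
  shows "\<exists>N. pscale (sigma ^ N) F \<in> qm_lift sos"
proof -
  let ?y = "\<lambda>k. (gen k :: 'n rpoly)\<^sup>2"
  have "\<forall>i j. \<exists>f. tform ?y D f (F $ i $ j) \<and>
      (\<forall>q x. (\<forall>i j. rank1 i j q = x $ i * x $ j) \<longrightarrow> f q = eval_poly x (F $ i $ j))"
    using assms(2) by (intro allI tform_homogeneous_ex) (simp add: homogeneous_pmat_iff)
  then obtain f where f: "\<And>i j. tform ?y D (f i j) (F $ i $ j)"
    and f_eval: "\<And>i j q x. (\<forall>i j. rank1 i j q = x $ i * x $ j) \<Longrightarrow>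
      f i j q = eval_poly x (F $ i $ j)"
    by metis
  define s where "s q = (\<Sum>k\<in>UNIV. q $ k)" for q :: "real ^ ('n \<times> 'n \<times> bool)"
  define K where "K = {q :: real ^ ('n \<times> 'n \<times> bool). (\<forall>j. 0 \<le> q $ j) \<and> s q = 1} \<times>
    sphere (0 :: real ^ 't) 1"
  have "\<exists>\<kappa>\<ge>0. \<exists>\<tau>>0. \<forall>p\<in>K.
    \<tau> \<le> (\<Sum>i\<in>UNIV. \<Sum>j\<in>UNIV. snd p $ i * f i j (fst p) * snd p $ j) + \<kappa> * penalty (fst p)"
  proof (rule compact_penalty)
    show "compact K" unfolding K_def s_def by (intro compact_Times compact_simplex compact_sphere)
    show "continuous_on K (\<lambda>p. \<Sum>i\<in>UNIV. \<Sum>j\<in>UNIV. snd p $ i * f i j (fst p) * snd p $ j)"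
      by (intro continuous_intros continuous_on_compose2[OF continuous_on_tform[OF f, of UNIV]]) auto
    show "continuous_on K (\<lambda>p. penalty (fst p))"
      by (intro continuous_on_compose2[OF continuous_on_tform[OF tform_penalty, of UNIV]]
          continuous_intros) auto
    fix p assume p: "p \<in> K"
    show "0 \<le> penalty (fst p)" by (rule penalty_nonneg)
    assume "penalty (fst p) = 0"
    then obtain x where x: "norm x = 1" "\<forall>i j. rank1 i j (fst p) = x $ i * x $ j"
      using penalty_eq_0[of "fst p"] p by (auto simp: K_def s_def)
    have "0 < snd p \<bullet> (eval_pmat x F *v snd p)"
      using p x(1) by (intro pos) (auto simp: K_def)
    then show "0 < (\<Sum>i\<in>UNIV. \<Sum>j\<in>UNIV. snd p $ i * f i j (fst p) * snd p $ j)"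
      by (simp add: inner_matrix_sum f_eval[OF x(2)])
  qed
  then obtain \<kappa> \<tau> where "\<tau> > 0" and \<tau>: "\<And>q v. (q, v) \<in> K \<Longrightarrow>
    \<tau> \<le> (\<Sum>i\<in>UNIV. \<Sum>j\<in>UNIV. v $ i * f i j q * v $ j) + \<kappa> * penalty q"
    by fastforce
  \<comment> \<open>The powers of \<open>s\<close> equalise the degrees \<open>D\<close> and 4 and
    are 1 on the simplex. The penalty becomes zero after substitution, so \<open>g\<close> still
    represents \<open>F\<close>, up to the factor \<open>sigma ^ 4\<close>.\<close>
  define g where "g i j q = s q ^ 4 * f i j q + \<kappa> * ((if i = j then penalty q * s q ^ D else 0))" for i j q
  have "\<exists>N. pscale (sigma ^ N) (pscale (sigma ^ 4) F) \<in> qm_lift sos"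
  proof (rule matrix_polya[where f = g and D = "4 + D", OF _ _ sum_gen_power2 \<open>\<tau> > 0\<close>])
    fix i j
    have 1: "tform ?y (4 + D) (\<lambda>q. s q ^ 4 * f i j q) (sigma ^ 4 * F $ i $ j)"
      unfolding s_def using tform_mult[OF tform_power[OF tform_sigma, of 4] f[of i j]] by simp
    have "tform ?y (4 + D) (\<lambda>q. penalty q * s q ^ D) 0"
      unfolding s_def using tform_mult[OF tform_penalty tform_power[OF tform_sigma, of D]] by simp
    then have "tform ?y (4 + D) (\<lambda>q. if i = j then penalty q * s q ^ D else 0) 0"
      using tform_0 by (cases "i = j") simp_all
    from tform.add[OF 1 tform_cmult[OF this, of \<kappa>]]
    show "tform ?y (4 + D) (g i j) (pscale (sigma ^ 4) F $ i $ j)"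
      by (simp add: g_def[abs_def])
  next
    show "symmetric_mat (pscale (sigma ^ 4) F)"
      using assms(1) by (simp add: symmetric_mat_iff)
  next
    fix q :: "real ^ ('n \<times> 'n \<times> bool)" and v :: "real ^ 't"
    assume q: "\<And>j. 0 \<le> q $ j" "(\<Sum>j\<in>UNIV. q $ j) = 1"
    have s: "s q = 1" using q(2) by (simp add: s_def)
    have "(\<Sum>i\<in>UNIV. \<Sum>j\<in>UNIV. v $ i * g i j q * v $ j) =
        (\<Sum>i\<in>UNIV. \<Sum>j\<in>UNIV. v $ i * f i j q * v $ j) +
        (\<Sum>i\<in>UNIV. \<Sum>j\<in>UNIV. if i = j then \<kappa> * penalty q * (v $ i)\<^sup>2 else 0)"
      unfolding sum.distrib[symmetric]
      by (intro sum.cong) (auto simp: g_def s algebra_simps power2_eq_square)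
    also have "(\<Sum>i\<in>UNIV. \<Sum>j\<in>UNIV. if i = j then \<kappa> * penalty q * (v $ i)\<^sup>2 else 0) =
        \<kappa> * penalty q * (norm v)\<^sup>2"
      by (simp add: norm_vec_def L2_set_def sum_nonneg sum_distrib_left)
    finally have eq: "(\<Sum>i\<in>UNIV. \<Sum>j\<in>UNIV. v $ i * g i j q * v $ j) =
        (\<Sum>i\<in>UNIV. \<Sum>j\<in>UNIV. v $ i * f i j q * v $ j) + \<kappa> * penalty q * (norm v)\<^sup>2" .
    show "\<tau> * (norm v)\<^sup>2 \<le> (\<Sum>i\<in>UNIV. \<Sum>j\<in>UNIV. v $ i * g i j q * v $ j)"
    proof (cases "v = 0")
      case True
      then show ?thesis by simp
    next
      case False
      define u where "u = (1 / norm v) *\<^sub>R v"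
      have v: "v $ i = norm v * u $ i" for i using False by (simp add: u_def)
      have "(q, u) \<in> K" using q False s by (simp add: K_def u_def)
      from \<tau>[OF this] have "\<tau> * (norm v)\<^sup>2 \<le>
          ((\<Sum>i\<in>UNIV. \<Sum>j\<in>UNIV. u $ i * f i j q * u $ j) + \<kappa> * penalty q) * (norm v)\<^sup>2"
        by (rule mult_right_mono) simp
      also have "\<dots> = (\<Sum>i\<in>UNIV. \<Sum>j\<in>UNIV. v $ i * f i j q * v $ j) + \<kappa> * penalty q * (norm v)\<^sup>2"
        unfolding distrib_right sum_distrib_right by (simp add: v power2_eq_square ac_simps)
      finally show ?thesis by (simp add: eq)
    qed
  qed
  then obtain N where "pscale (sigma ^ N) (pscale (sigma ^ 4) F) \<in> qm_lift sos" by blast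
  moreover have "pscale (sigma ^ N) (pscale (sigma ^ 4) F) = pscale (sigma ^ (N + 4)) F"
    by (simp add: vec_eq_iff power_add mult.assoc)
  ultimately show ?thesis by auto
qed

section \<open>The Positivstellensatz\<close>

lemma sos_0: "0 \<in> sos"
  by (simp add: sos_def)

lemma sos_mult:
  assumes "a \<in> sos" "b \<in> sos"
  shows "a * b \<in> sos"
  unfolding sos_def
proof (rule finite_sums_map[OF assms(1)[unfolded sos_def], of "\<lambda>a. a * b"])
  fix a :: "'a rpoly" assume "a \<in> {p\<^sup>2 |p. True}"
  then obtain p where p: "a = p\<^sup>2" by blast
  show "a * b \<in> finite_sums {p\<^sup>2 |p. True}"
  proof (rule finite_sums_map[OF assms(2)[unfolded sos_def], of "\<lambda>b. a * b"])
    fix b :: "'a rpoly" assume "b \<in> {p\<^sup>2 |p. True}"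
    then obtain q where "b = q\<^sup>2" by blast
    then have "a * b = (p * q)\<^sup>2" by (simp add: p power_mult_distrib)
    then show "a * b \<in> finite_sums {p\<^sup>2 |p. True}" by (auto intro: finite_sums_base)
  qed (auto simp: distrib_left)
qed (auto simp: distrib_right)

lemma sigma_power_in_sos: "(sigma :: 'n::finite rpoly) ^ k \<in> sos"
proof (induction k)
  case 0
  show ?case using square_in_sos[of 1] by simp
next
  case (Suc k)
  have "(sigma :: 'n rpoly) \<in> sos"
    unfolding sigma_def sos_def by (intro finite_sums_sum finite_sums_base) blast
  then show ?case using Suc by (simp add: sos_mult)
qed

lemma sos_subset_scalar_qm: "sos \<subseteq> scalar_qm G"
proof
  fix s :: "'a rpoly" assume "s \<in> sos"
  then show "s \<in> scalar_qm G"
    unfolding scalar_qm_def mem_Collect_eq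
    by (intro exI[of _ 0] exI[of _ "\<lambda>_. s"] exI[of _ "\<lambda>_. 0"]) simp
qed

lemma sos_mult_in_scalar_qm: "s \<in> sos \<Longrightarrow> g \<in> G \<Longrightarrow> s * g \<in> scalar_qm G"
  unfolding scalar_qm_def mem_Collect_eq
  by (intro exI[of _ 1] exI[of _ "\<lambda>i. if i = 0 then 0 else s"] exI[of _ "\<lambda>_. g"]) (auto simp: sos_0)

lemma qm_lift_mono: "M \<subseteq> M' \<Longrightarrow> qm_lift M \<subseteq> qm_lift M'"
  unfolding qm_lift_def finite_sums_def by (intro image_mono lists_mono) blast

lemma qm_lift_pscale_mat_1: "m \<in> M \<Longrightarrow> pscale m (mat 1) \<in> qm_lift M"
  using qm_lift_base[of m M "mat 1"] by (simp add: transpose_mat)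

lemma pscale_add_left: "pscale (p + q) A = pscale p A + pscale q A"
  by (simp add: vec_eq_iff distrib_right)

lemma pscale_0_left [simp]: "pscale 0 A = 0"
  by (simp add: vec_eq_iff)

lemma pscale_sum_left: "pscale (\<Sum>i\<in>I. p i) A = (\<Sum>i\<in>I. pscale (p i) A)"
  by (induction I rule: infinite_finite_induct) (auto simp: pscale_add_left)

lemma pscale_pscale: "pscale p (pscale q A) = pscale (p * q) A"
  by (simp add: vec_eq_iff mult.assoc)

lemma pscale_diff: "pscale p (A - B) = pscale p A - pscale p B"
  by (simp add: vec_eq_iff right_diff_distrib)

text \<open>For a single square \<open>s = p\<^sup>2\<close> the matrix is the congruence of
  \<open>pscale g (mat 1)\<close> by \<open>pscale p A\<close>; sums follow by additivity in
  \<open>s\<close>.\<close>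

lemma pscale_mult_in_matrix_qm:
  fixes A :: "('n::finite, 't::finite) pmat"
  assumes "pscale g (mat 1) \<in> matrix_qm \<G>" "s \<in> sos"
  shows "pscale (s * g) (transpose A ** A) \<in> matrix_qm \<G>"
  unfolding matrix_qm_def
proof (rule finite_sums_map[OF assms(2)[unfolded sos_def],
      of "\<lambda>s. pscale (s * g) (transpose A ** A)"])
  fix s :: "'n rpoly" assume "s \<in> {p\<^sup>2 |p. True}"
  then obtain p where p: "s = p\<^sup>2" by blast
  have "pscale (s * g) (transpose A ** A) = transpose (pscale p A) ** pscale g (mat 1) ** pscale p A"
  proof -
    have "pscale g (mat 1) ** B = pscale g B" for B :: "('n, 't) pmat"
    proof -
      have "(pscale g (mat 1) ** B) $ i $ j = (\<Sum>k\<in>UNIV. if i = k then g * B $ k $ j else 0)" for i j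
        unfolding matrix_matrix_mult_def by (simp add: mat_def if_distrib if_distribR cong: if_cong)
      then show ?thesis by (simp add: vec_eq_iff)
    qed
    then show ?thesis
      by (simp add: matrix_mul_assoc[symmetric])
        (simp add: vec_eq_iff matrix_matrix_mult_def transpose_def p power2_eq_square sum_distrib_left ac_simps)
  qed
  then show "pscale (s * g) (transpose A ** A) \<in>
      finite_sums {transpose A ** G ** A |A G. G \<in> \<G> \<union> {mat 1}}"
    using matrix_qm_congruence[OF assms(1), of "pscale p A"] by (simp add: matrix_qm_def)
qed (auto simp: distrib_right pscale_add_left)

lemma qm_lift_scalar_qm_subset:
  fixes \<G> :: "('n::finite, 't::finite) pmat set"
  assumes "\<And>g. g \<in> G \<Longrightarrow> pscale g (mat 1) \<in> matrix_qm \<G>"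
  shows "qm_lift (scalar_qm G) \<subseteq> matrix_qm \<G>"
proof
  fix X :: "('n, 't) pmat" assume X: "X \<in> qm_lift (scalar_qm G)"
  show "X \<in> matrix_qm \<G>"
    unfolding matrix_qm_def
  proof (rule finite_sums_map[OF X[unfolded qm_lift_def], of "\<lambda>X. X"])
    fix X :: "('n, 't) pmat"
    assume "X \<in> {pscale p (transpose A ** A) |p (A :: ('n, 't) pmat). p \<in> scalar_qm G}"
    then obtain A :: "('n, 't) pmat" and p where Xp: "X = pscale p (transpose A ** A)"
      and p: "p \<in> scalar_qm G"
      by blast
    from p obtain m :: nat and s g where psum: "p = s 0 + (\<Sum>i=1..m. s i * g i)"
      and s: "\<forall>i\<in>{0..m}. s i \<in> sos" and g: "\<forall>i\<in>{1..m}. g i \<in> G"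
      unfolding scalar_qm_def by blast
    \<comment> \<open>The free term \<open>s 0\<close> is treated as \<open>s 0 * 1\<close>, with 1
      in the role of a constraint.\<close>
    have "pscale 1 (mat 1) = transpose (mat 1) ** mat 1 ** (mat 1 :: ('n, 't) pmat)"
      by (simp add: transpose_mat vec_eq_iff)
    then have "pscale 1 (mat 1) \<in> matrix_qm \<G>" by (simp only: matrix_qm_base insertI1 Un_iff simp_thms)
    then have "pscale (s 0 * 1) (transpose A ** A) \<in> matrix_qm \<G>"
      using s by (intro pscale_mult_in_matrix_qm) auto
    moreover have "pscale (s i * g i) (transpose A ** A) \<in> matrix_qm \<G>" if "i \<in> {1..m}" for i
      using s g assms that by (intro pscale_mult_in_matrix_qm) auto
    ultimately have "X \<in> matrix_qm \<G>"
      unfolding Xp psum pscale_add_left pscale_sum_left by (intro matrix_qm_add matrix_qm_sum) auto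
    then show "X \<in> finite_sums {transpose A ** G ** A |A G. G \<in> \<G> \<union> {mat 1}}"
      by (simp add: matrix_qm_def)
  qed auto
qed

section \<open>From constraints on the sphere to the scalar quadratic module\<close>

text \<open>Bernoulli's inequality twice. For \<open>g \<ge> 0\<close>, it bounds
  \<open>(1 + 2 * k * g) * (1 - g) ^ (2 * k)\<close> by \<open>(1 - g\<^sup>2) ^ (2 * k)\<close>,
  hence by 1; for \<open>g < 0\<close> it bounds the power from below.\<close>

lemma penalty_power_bound:
  fixes g :: real
  assumes "g \<le> 1" "k > 0"
  shows "2 * real k * (max 0 (- g))\<^sup>2 - 1 / (2 * real k) \<le> - (g * (1 - g) ^ (2 * k))"
proof (cases "g \<ge> 0")
  case True
  have "(1 + real (2 * k) * g) * (1 - g) ^ (2 * k) \<le> (1 + g) ^ (2 * k) * (1 - g) ^ (2 * k)"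
    using True assms by (intro mult_right_mono Bernoulli_inequality) auto
  also have "\<dots> = (1 - g\<^sup>2) ^ (2 * k)"
    by (simp add: power_mult_distrib[symmetric] power2_eq_square algebra_simps)
  also have "\<dots> \<le> 1"
    using True assms by (intro power_le_one) (auto simp: power_le_one)
  finally have "2 * real k * (g * (1 - g) ^ (2 * k)) + (1 - g) ^ (2 * k) \<le> 1"
    by (simp add: algebra_simps)
  moreover have "0 \<le> (1 - g) ^ (2 * k)" using assms(1) by simp
  ultimately have "2 * real k * (g * (1 - g) ^ (2 * k)) \<le> 1" by linarith
  then show ?thesis using True assms by (simp add: field_simps)
next
  case False
  have "- g * (1 + real (2 * k) * (- g)) \<le> - g * (1 + (- g)) ^ (2 * k)"
    using False by (intro mult_left_mono Bernoulli_inequality) auto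
  then have "2 * real k * (max 0 (- g))\<^sup>2 \<le> - (g * (1 - g) ^ (2 * k))"
    using False by (simp add: power2_eq_square algebra_simps)
  moreover have "0 \<le> 1 / (2 * real k)" by simp
  ultimately show ?thesis by linarith
qed

text \<open>Up to a power of \<open>sigma\<close>, \<open>H\<close> is split into a matrix
  \<open>F\<close> that is positive definite on the sphere, handled by
  \<open>positive_on_sphere\<close>, and a scalar multiple \<open>P\<close> of the identity whose
  summands lie in the scalar module.\<close>

lemma homogeneous_positivstellensatz:
  fixes H :: "('n::finite, 't::finite) pmat"
  assumes "finite G" and hom: "\<forall>g\<in>G. \<exists>e. even e \<and> homogeneous_poly e g"
    and H: "symmetric_mat H" "homogeneous_pmat (2 * D) H"
    and pos: "\<And>x v. norm x = 1 \<Longrightarrow> norm v = 1 \<Longrightarrow> (\<And>g. g \<in> G \<Longrightarrow> 0 \<le> eval_poly x g) \<Longrightarrow>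
      0 < v \<bullet> (eval_pmat x H *v v)"
  shows "\<exists>N. pscale (sigma ^ N) H \<in> qm_lift (scalar_qm G)"
proof -
  have "\<forall>g\<in>G. \<exists>e. homogeneous_poly (2 * e) g"
    using hom by (metis evenE)
  from bchoice[OF this] obtain e where e: "\<And>g. g \<in> G \<Longrightarrow> homogeneous_poly (2 * e g) g"
    by blast
  have "\<forall>g. \<exists>\<beta>\<noteq>0. \<forall>x :: real ^ 'n. norm x = 1 \<longrightarrow> eval_poly x (PConst (\<beta>\<^sup>2) * g) \<le> 1"
  proof
    fix g :: "'n rpoly"
    have "compact ((\<lambda>x. eval_poly x g) ` sphere (0 :: real ^ 'n) 1)"
      by (intro compact_continuous_image continuous_on_eval_poly compact_sphere)
    then obtain a where a: "\<And>x :: real ^ 'n. norm x = 1 \<Longrightarrow> \<bar>eval_poly x g\<bar> \<le> a"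
      by (force dest!: compact_imp_bounded simp: bounded_iff)
    show "\<exists>\<beta>\<noteq>0. \<forall>x :: real ^ 'n. norm x = 1 \<longrightarrow> eval_poly x (PConst (\<beta>\<^sup>2) * g) \<le> 1"
    \<comment> \<open>Scaling by a square keeps the sign of \<open>g\<close> and can later be
      absorbed into the sum-of-squares multiplier.\<close>
    proof (intro exI[of _ "1 / sqrt (1 + \<bar>a\<bar>)"] conjI allI impI)
      fix x :: "real ^ 'n" assume "norm x = 1"
      then show "eval_poly x (PConst ((1 / sqrt (1 + \<bar>a\<bar>))\<^sup>2) * g) \<le> 1"
        using a[of x] by (simp add: eval_poly_mult power_divide divide_simps) linarith
    qed auto
  qed
  from choice[OF this] obtain \<beta> where \<beta>: "\<And>g. \<beta> g \<noteq> (0 :: real)"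
    and le_1: "\<And>g x. norm (x :: real ^ 'n) = 1 \<Longrightarrow> eval_poly x (PConst ((\<beta> g)\<^sup>2) * g) \<le> 1"
    by blast
  define h where "h g = PConst ((\<beta> g)\<^sup>2) * g" for g :: "'n rpoly"
  define K where "K = sphere (0 :: real ^ 'n) 1 \<times> sphere (0 :: real ^ 't) 1"
  have "\<exists>\<kappa>\<ge>0. \<exists>\<tau>>0. \<forall>p\<in>K. \<tau> \<le> (\<Sum>i\<in>UNIV. \<Sum>j\<in>UNIV. snd p $ i * eval_poly (fst p) (H $ i $ j) * snd p $ j)
      + \<kappa> * (\<Sum>g\<in>G. (max 0 (- eval_poly (fst p) (h g)))\<^sup>2)"
  proof (rule compact_penalty)
    show "compact K" unfolding K_def by (intro compact_Times compact_sphere)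
    show "continuous_on K (\<lambda>p. \<Sum>i\<in>UNIV. \<Sum>j\<in>UNIV. snd p $ i * eval_poly (fst p) (H $ i $ j) * snd p $ j)"
      by (intro continuous_intros continuous_on_compose2[OF continuous_on_eval_poly[of UNIV]]) auto
    show "continuous_on K (\<lambda>p. \<Sum>g\<in>G. (max 0 (- eval_poly (fst p) (h g)))\<^sup>2)"
      by (intro continuous_intros continuous_on_compose2[OF continuous_on_eval_poly[of UNIV]]) auto
    fix p assume p: "p \<in> K"
    show "0 \<le> (\<Sum>g\<in>G. (max 0 (- eval_poly (fst p) (h g)))\<^sup>2)" by (intro sum_nonneg) simp
    assume "(\<Sum>g\<in>G. (max 0 (- eval_poly (fst p) (h g)))\<^sup>2) = 0"
    then have "max 0 (- eval_poly (fst p) (h g)) = 0" if "g \<in> G" for g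
      using assms(1) that by (simp add: sum_nonneg_eq_0_iff)
    then have "0 \<le> eval_poly (fst p) (h g)" if "g \<in> G" for g
      using that by (metis max.cobounded2 neg_le_0_iff_le)
    then have "0 \<le> eval_poly (fst p) g" if "g \<in> G" for g
      using that \<beta>[of g] by (fastforce simp: h_def eval_poly_mult zero_le_mult_iff)
    then have "0 < snd p \<bullet> (eval_pmat (fst p) H *v snd p)"
      using p by (intro pos) (auto simp: K_def)
    then show "0 < (\<Sum>i\<in>UNIV. \<Sum>j\<in>UNIV. snd p $ i * eval_poly (fst p) (H $ i $ j) * snd p $ j)"
      by (simp add: inner_matrix_sum)
  qed
  then obtain \<kappa> \<tau> where "\<kappa> \<ge> 0" "\<tau> > 0" and \<tau>: "\<And>x v. (x, v) \<in> K \<Longrightarrow>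
      \<tau> \<le> v \<bullet> (eval_pmat x H *v v) + \<kappa> * (\<Sum>g\<in>G. (max 0 (- eval_poly x (h g)))\<^sup>2)"
    by (fastforce simp: inner_matrix_sum)
  \<comment> \<open>The first bound lets \<open>2 * k\<close> replace \<open>\<kappa>\<close>; the
    second keeps the total loss \<open>card G / (2 * k)\<close> below \<open>\<tau>\<close>.\<close>
  obtain k :: nat where k0: "max \<kappa> (card G / \<tau>) < k" using reals_Archimedean2 by blast
  have k: "k > 0" "\<kappa> \<le> 2 * real k" "card G / (2 * real k) < \<tau>"
  proof -
    show "k > 0" "\<kappa> \<le> 2 * real k" using k0 \<open>\<kappa> \<ge> 0\<close> by auto
    have "card G < k * \<tau>" using k0 \<open>\<tau> > 0\<close> by (simp add: pos_divide_less_eq)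
    moreover have "0 < k * \<tau>" using \<open>k > 0\<close> \<open>\<tau> > 0\<close> by simp
    ultimately show "card G / (2 * real k) < \<tau>"
      using \<open>k > 0\<close> by (simp add: pos_divide_less_eq algebra_simps)
  qed
  \<comment> \<open>The summand for \<open>g\<close> has degree \<open>2 * e g * (2 * k + 1)\<close>
    before padding by \<open>sigma ^ a g\<close>. Since \<open>L\<close> includes every such
    half-degree, the subtraction in \<open>a g\<close> is exact for \<open>g\<close> in
    \<open>G\<close> and all summands reach degree \<open>2 * (D + L)\<close>.\<close>
  define L where "L = (\<Sum>g\<in>G. e g * (2 * k + 1))"
  define a where "a g = D + L - e g * (2 * k + 1)" for g
  have deg: "a g + (e g + e g * (2 * k)) = D + L" if "g \<in> G" for g
    using member_le_sum[OF that, of "\<lambda>g. e g * (2 * k + 1)"] assms(1)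
    by (simp add: a_def L_def)
  define P where "P = (\<Sum>g\<in>G. sigma ^ a g * (h g * (sigma ^ e g - h g) ^ (2 * k)))"
  define F where "F = pscale (sigma ^ L) H - pscale P (mat 1)"
  have hom_P: "homogeneous_poly (2 * (D + L)) P"
    unfolding P_def
  proof (rule homogeneous_poly_sum)
    fix g assume g: "g \<in> G"
    have h: "homogeneous_poly (2 * e g) (h g)"
      unfolding h_def using homogeneous_poly_mult[OF homogeneous_poly_PConst e[OF g]] by simp
    have "homogeneous_poly (2 * a g + (2 * e g + 2 * k * (2 * e g)))
        (sigma ^ a g * (h g * (sigma ^ e g - h g) ^ (2 * k)))"
      by (intro homogeneous_poly_mult homogeneous_poly_power homogeneous_poly_diff
          homogeneous_poly_sigma_power h)
    moreover have "2 * a g + (2 * e g + 2 * k * (2 * e g)) = 2 * (D + L)"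
      unfolding deg[OF g, symmetric] by (simp add: algebra_simps)
    ultimately show "homogeneous_poly (2 * (D + L)) (sigma ^ a g * (h g * (sigma ^ e g - h g) ^ (2 * k)))"
      by simp
  qed
  have "\<exists>N. pscale (sigma ^ N) F \<in> qm_lift sos"
  proof (rule positive_on_sphere)
    show "symmetric_mat F" using H(1) by (auto simp: F_def symmetric_mat_iff mat_def)
    show "homogeneous_pmat (2 * (D + L)) F"
      unfolding homogeneous_pmat_iff
    proof (intro allI)
      fix i j
      have "homogeneous_poly (2 * L + 2 * D) (sigma ^ L * H $ i $ j)"
        using H(2) by (intro homogeneous_poly_mult homogeneous_poly_sigma_power)
          (simp add: homogeneous_pmat_iff)
      then show "homogeneous_poly (2 * (D + L)) (F $ i $ j)"
        using hom_P by (auto simp: F_def mat_def algebra_simps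
            intro!: homogeneous_poly_diff homogeneous_poly_uminus)
    qed
    fix x :: "real ^ 'n" and v :: "real ^ 't" assume x: "norm x = 1" and v: "norm v = 1"
    have \<sigma>: "eval_poly x sigma = 1" using x by (simp add: eval_poly_sigma)
    have P: "eval_poly x P = (\<Sum>g\<in>G. eval_poly x (h g) * (1 - eval_poly x (h g)) ^ (2 * k))"
      by (simp add: P_def eval_poly_simps \<sigma>)
    have "eval_pmat x F = eval_pmat x H - eval_poly x P *\<^sub>R mat 1"
      by (simp add: F_def vec_eq_iff eval_poly_simps \<sigma> mat_def)
    then have "v \<bullet> (eval_pmat x F *v v) = v \<bullet> (eval_pmat x H *v v) - eval_poly x P"
      using v by (simp add: matrix_vector_mult_diff_rdistrib scaleR_matrix_vector_assoc[symmetric]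
          inner_diff_right dot_square_norm)
    moreover have "\<kappa> * (\<Sum>g\<in>G. (max 0 (- eval_poly x (h g)))\<^sup>2) - card G / (2 * real k) \<le> - eval_poly x P"
    proof -
      have "\<kappa> * (\<Sum>g\<in>G. (max 0 (- eval_poly x (h g)))\<^sup>2) - card G / (2 * real k) \<le>
          2 * real k * (\<Sum>g\<in>G. (max 0 (- eval_poly x (h g)))\<^sup>2) - card G / (2 * real k)"
        using k(2) by (intro diff_right_mono mult_right_mono sum_nonneg) auto
      also have "\<dots> = (\<Sum>g\<in>G. 2 * real k * (max 0 (- eval_poly x (h g)))\<^sup>2 - 1 / (2 * real k))"
        by (simp add: sum_subtractf sum_distrib_left)
      also have "\<dots> \<le> (\<Sum>g\<in>G. - (eval_poly x (h g) * (1 - eval_poly x (h g)) ^ (2 * k)))"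
        using le_1[OF x] k(1) by (intro sum_mono penalty_power_bound) (auto simp: h_def)
      finally show ?thesis by (simp add: P sum_negf)
    qed
    moreover have "\<tau> \<le> v \<bullet> (eval_pmat x H *v v) + \<kappa> * (\<Sum>g\<in>G. (max 0 (- eval_poly x (h g)))\<^sup>2)"
      using x v by (intro \<tau>) (simp add: K_def)
    ultimately show "0 < v \<bullet> (eval_pmat x F *v v)" using k(3) by linarith
  qed
  then obtain N where N: "pscale (sigma ^ N) F \<in> qm_lift sos" by blast
  have "sigma ^ N * (sigma ^ a g * (h g * (sigma ^ e g - h g) ^ (2 * k))) \<in> scalar_qm G" if "g \<in> G" for g
  proof -
    \<comment> \<open>The even exponent \<open>2 * k\<close> makes the whole multiplier of
      \<open>g\<close> a sum of squares.\<close>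
    have "sigma ^ N * sigma ^ a g * ((PConst (\<beta> g))\<^sup>2 * ((sigma ^ e g - h g) ^ k)\<^sup>2) * g \<in> scalar_qm G"
      using that by (intro sos_mult_in_scalar_qm sos_mult sigma_power_in_sos square_in_sos)
    moreover have "sigma ^ N * sigma ^ a g * ((PConst (\<beta> g))\<^sup>2 * ((sigma ^ e g - h g) ^ k)\<^sup>2) * g =
        sigma ^ N * (sigma ^ a g * (h g * (sigma ^ e g - h g) ^ (2 * k)))"
    proof -
      have hg: "(PConst (\<beta> g))\<^sup>2 * g = h g" by (simp add: h_def PConst_power)
      show ?thesis
        unfolding power_even_eq hg[symmetric] by (simp add: ac_simps)
    qed
    ultimately show ?thesis by simp
  qed
  then have "(\<Sum>g\<in>G. pscale (sigma ^ N * (sigma ^ a g * (h g * (sigma ^ e g - h g) ^ (2 * k)))) (mat 1)) \<in>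
      (qm_lift (scalar_qm G) :: ('n, 't) pmat set)"
    by (intro qm_lift_sum qm_lift_pscale_mat_1)
  moreover have "pscale (sigma ^ N) F \<in> qm_lift (scalar_qm G)"
    using N qm_lift_mono[OF sos_subset_scalar_qm] by blast
  moreover have "pscale (sigma ^ (N + L)) H = pscale (sigma ^ N) F +
      (\<Sum>g\<in>G. pscale (sigma ^ N * (sigma ^ a g * (h g * (sigma ^ e g - h g) ^ (2 * k)))) (mat 1))"
    by (simp add: F_def P_def pscale_diff pscale_pscale power_add flip: pscale_sum_left sum_distrib_left)
  ultimately have "pscale (sigma ^ (N + L)) H \<in> qm_lift (scalar_qm G)"
    by (simp only: qm_lift_add)
  then show ?thesis by blast
qed

section \<open>Forms nonnegative on \<open>K_set\<close>\<close>

theorem theorem6p2: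
  fixes \<G> :: "('n::finite, 't::finite) pmat set"
    and F :: "('n, 't) pmat"
    and d :: nat
  assumes "finite \<G>"
    and "\<forall>G\<in>\<G>. symmetric_mat G"
    and "\<forall>G\<in>\<G>. \<exists>e. even e \<and> homogeneous_pmat e G"
    and "symmetric_mat F"
    and "homogeneous_pmat d F"
    and "even d" and "d > 0"
    and "\<forall>x\<in>K_set \<G>. psd (eval_pmat x F)"
  shows "\<exists>(G :: 'n rpoly set) (lam :: real).
    finite G \<and> (\<forall>g\<in>G. \<exists>e. even e \<and> homogeneous_poly e g) \<and> lam > 0 \<and>
    (\<forall>\<epsilon>::real. \<epsilon> > 0 \<longrightarrow>
      (\<exists>N::nat. N > 0 \<and> N \<ge> d div 2 \<and>
        pscale (sigma ^ (N - d div 2))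
          (F + pscale (PConst (\<epsilon> / lam ^ d) * sigma ^ (d div 2)) (mat 1))
          \<in> qm_lift (scalar_qm G) \<and>
        (qm_lift (scalar_qm G) :: ('n, 't) pmat set) \<subseteq> matrix_qm \<G>))"
proof -
  have "\<forall>H\<in>\<G>. \<exists>W. finite W \<and> (\<forall>w\<in>W. (\<exists>e. even e \<and> homogeneous_poly e w) \<and>
      pscale w (mat 1) \<in> matrix_qm {H}) \<and>
    (\<forall>x. (\<forall>w\<in>W. 0 \<le> eval_poly x w) \<longrightarrow> psd (eval_pmat x H))"
  proof
    fix H assume "H \<in> \<G>"
    then obtain e where "symmetric_mat H" "homogeneous_pmat e H" "even e"
      using assms(2,3) by blast
    then show "\<exists>W. finite W \<and> (\<forall>w\<in>W. (\<exists>e. even e \<and> homogeneous_poly e w) \<and>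
        pscale w (mat 1) \<in> matrix_qm {H}) \<and>
      (\<forall>x. (\<forall>w\<in>W. 0 \<le> eval_poly x w) \<longrightarrow> psd (eval_pmat x H))"
      by (rule scalarization)
  qed
  from bchoice[OF this] obtain W where W:
    "\<forall>H\<in>\<G>. finite (W H) \<and> (\<forall>w\<in>W H. (\<exists>e. even e \<and> homogeneous_poly e w) \<and>
      pscale w (mat 1) \<in> matrix_qm {H}) \<and>
    (\<forall>x. (\<forall>w\<in>W H. 0 \<le> eval_poly x w) \<longrightarrow> psd (eval_pmat x H))" ..
  have fin: "finite (W H)"
    and hom: "\<And>w. w \<in> W H \<Longrightarrow> \<exists>e. even e \<and> homogeneous_poly e w"
    and qm: "\<And>w. w \<in> W H \<Longrightarrow> pscale w (mat 1) \<in> matrix_qm {H}"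
    and psd: "\<And>x. (\<forall>w\<in>W H. 0 \<le> eval_poly x w) \<Longrightarrow> psd (eval_pmat x H)" if "H \<in> \<G>" for H
    using bspec[OF W that] by simp_all
  define G where "G = (\<Union>H\<in>\<G>. W H)"
  have G: "finite G" "\<forall>g\<in>G. \<exists>e. even e \<and> homogeneous_poly e g"
    using assms(1) fin hom by (auto simp: G_def)
  have "pscale g (mat 1) \<in> matrix_qm \<G>" if gG: "g \<in> G" for g
  proof -
    obtain H where H: "H \<in> \<G>" "g \<in> W H" using gG by (auto simp: G_def)
    have "H = transpose (mat 1) ** H ** mat 1" by (simp add: transpose_mat)
    then have "{H} \<subseteq> matrix_qm \<G>" using matrix_qm_base[of H \<G> "mat 1"] H(1) by simp
    then show ?thesis by (rule matrix_qm_trans[OF qm[OF H]])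
  qed
  then have subset: "(qm_lift (scalar_qm G) :: ('n, 't) pmat set) \<subseteq> matrix_qm \<G>"
    by (rule qm_lift_scalar_qm_subset)
  have ex: "\<exists>N. pscale (sigma ^ N) (F + pscale (PConst (\<epsilon> / 1 ^ d) * sigma ^ (d div 2)) (mat 1))
      \<in> qm_lift (scalar_qm G)" if "\<epsilon> > 0" for \<epsilon> :: real
  proof (rule homogeneous_positivstellensatz[OF G])
    let ?H = "F + pscale (PConst (\<epsilon> / 1 ^ d) * sigma ^ (d div 2)) (mat 1)"
    show "symmetric_mat ?H" using assms(4) by (auto simp: symmetric_mat_iff mat_def)
    have "homogeneous_poly (0 + 2 * (d div 2)) (PConst (\<epsilon> / 1 ^ d) * sigma ^ (d div 2) :: 'n rpoly)"
      by (intro homogeneous_poly_mult homogeneous_poly_PConst homogeneous_poly_sigma_power)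
    then show "homogeneous_pmat (2 * (d div 2)) ?H"
      using assms(5,6) by (auto simp: homogeneous_pmat_iff mat_def intro!: homogeneous_poly_add)
    fix x :: "real ^ 'n" and v :: "real ^ 't"
    assume x: "norm x = 1" and v: "norm v = 1" and g: "\<And>g. g \<in> G \<Longrightarrow> 0 \<le> eval_poly x g"
    \<comment> \<open>The constraints collected in \<open>G\<close> force every matrix of
      \<open>\<G>\<close> to be positive semidefinite at \<open>x\<close>, so the hypothesis on
      \<open>F\<close> applies; the term with \<open>\<epsilon>\<close> makes the inequality
      strict.\<close>
    have "x \<in> K_set \<G>" unfolding K_set_def G_def using psd g[unfolded G_def] by blast
    then have "0 \<le> v \<bullet> (eval_pmat x F *v v)" using assms(8) by (simp add: psd_def)
    moreover have "eval_pmat x ?H = eval_pmat x F + \<epsilon> *\<^sub>R mat 1"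
      using x by (simp add: vec_eq_iff eval_poly_simps eval_poly_sigma mat_def)
    then have "v \<bullet> (eval_pmat x ?H *v v) = v \<bullet> (eval_pmat x F *v v) + \<epsilon>"
      using v by (simp add: matrix_vector_mult_add_rdistrib scaleR_matrix_vector_assoc[symmetric]
          inner_add_right dot_square_norm)
    ultimately show "0 < v \<bullet> (eval_pmat x ?H *v v)" using that by simp
  qed
  have "\<exists>N>0. N \<ge> d div 2 \<and> pscale (sigma ^ (N - d div 2))
      (F + pscale (PConst (\<epsilon> / 1 ^ d) * sigma ^ (d div 2)) (mat 1)) \<in> qm_lift (scalar_qm G) \<and>
      (qm_lift (scalar_qm G) :: ('n, 't) pmat set) \<subseteq> matrix_qm \<G>" if "\<epsilon> > 0" for \<epsilon> :: real
  proof -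
    obtain N where "pscale (sigma ^ N)
      (F + pscale (PConst (\<epsilon> / 1 ^ d) * sigma ^ (d div 2)) (mat 1)) \<in> qm_lift (scalar_qm G)"
      using ex[OF \<open>\<epsilon> > 0\<close>] by blast
    then show ?thesis
      \<comment> \<open>Adding \<open>d div 2\<close> makes the subtraction in the exponent exact,
        and the sum is positive because \<open>d\<close> is even and positive.\<close>
      using subset assms(6,7) by (intro exI[of _ "N + d div 2"]) (auto elim: evenE)
  qed
  then show ?thesis using G by (intro exI[of _ G] exI[of _ 1]) auto
qed

end
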